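(* Let $\Omega$ be a locally compact Hausdorff space, $\alpha:\Omega\to\Omega$ an aperiodic homeomorphism, and $w:\Omega\to(0,\infty)$ a bounded positive function with $w^{-1}=1/w\in C_b(\Omega)$. Then the following statements are equivalent. (i) $T_{\alpha,w}^{*}$ is topologically hyper-transitive on $M(\Omega)$. (ii) For every compact subset $K$ of $\Omega$ and any two measures $\mu,v\in M(\Omega)$ with $|v|(K^{c})=|\mu|(K^{c})=0$ there exist a strictly increasing sequence $\{n_k\}_k\subseteq\mathbb{N}$ and sequences $\{A_k\}_k,\{B_k\}_k$ of Borel subsets of $K$ such that $\alpha^{n_k}(K)\cap K=\varnothing$ for all $k\in\mathbb{N}$ and $$\lim_{k\to\infty}|\mu|(A_k)=\lim_{k\to\infty}|v|(B_k)=0,$$ $$\lim_{k\to\infty}\ \sup_{t\in K\cap A_k^{c}}\Big(\prod_{j=0}^{n_k-1}(w\circ\alpha^{j})(t)\Big)=\lim_{k\to\infty}\ \sup_{t\in K\cap B_k^{c}}\Big(\prod_{j=1}^{n_k}(w\circ\alpha^{-j})^{-1}(t)\Big)=0.$$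
   Context: $\mathbb{N}=\{1,2,\dots\}$. For $n\in\mathbb{N}$, $\alpha^n$ is the $n$-fold composition of $\alpha$ with itself, $\alpha^0=\mathrm{id}$, $\alpha^{-n}=(\alpha^{-1})^n$. A homeomorphism $\alpha$ of $\Omega$ is aperiodic if for each compact $K\subseteq\Omega$ there is $N>0$ such that $K\cap\alpha^n(K)=\varnothing$ for all $n\ge N$. $C_0(\Omega)$ is the space of continuous complex functions on $\Omega$ vanishing at infinity and $C_b(\Omega)$ that of bounded continuous functions, both with the supremum norm. $(w\circ\alpha^{-j})^{-1}$ denotes the pointwise reciprocal $1/(w\circ\alpha^{-j})$. The weighted composition operator $T_{\alpha,w}$ on $C_0(\Omega)$ is $T_{\alpha,w}f=w\cdot(f\circ\alpha)$; it is bounded and invertible. $M(\Omega)$ is the Banach space of complex Radon measures on $\Omega$ with the total variation norm $\|\mu\|=|\mu|(\Omega)$, identified with the dual of $C_0(\Omega)$ via $\mu\mapsto(f\mapsto\int f\,d\mu)$; $T_{\alpha,w}^*$ is the adjoint of $T_{\alpha,w}$ acting on $M(\Omega)$, i.e. $T_{\alpha,w}^*(\mu)(E)=\int_E w\circ\alpha^{-1}\,d(\mu\circ\alpha^{-1})$ for Borel $E$, where $(\mu\circ\alpha^{-1})(E)=\mu(\alpha^{-1}(E))$. A bounded operator $T$ on a Banach space $\mathcal X$ is topologically hyper-transitive if for all non-empty open $U,V\subseteq\mathcal X$ there is a strictly increasing sequence $\{n_k\}_k\subseteq\mathbb{N}$ with $T^{n_k}(U)\cap V\neq\varnothing$ for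 all $k\in\mathbb{N}$. Complements are taken in $\Omega$. The supremum of a nonnegative quantity over the empty set is taken to be $0$. *)

theory Defs
  imports "HOL-Analysis.Analysis"
begin

section \<open>Vector measures on the Borel sets and their total variation\<close>

text \<open>
  A set function is represented by a total function on \<open>'a set\<close>; only its values on Borel sets
  matter.  The library's \<^const>\<open>countably_additive\<close> is restricted to
  \<^typ>\<open>ennreal\<close>-valued functions, so the analogue for normed spaces is stated here.  It entails
  that the empty set has measure \<open>0\<close>, since constant series only converge for the constant \<open>0\<close>.
\<close>

definition borel_vector_measure :: "('a::topological_space set \<Rightarrow> 'b::real_normed_vector) \<Rightarrow> bool" where
  "borel_vector_measure \<nu> \<longleftrightarrow>
     (\<forall>A. range A \<subseteq> sets borel \<longrightarrow> disjoint_family A \<longrightarrow> (\<lambda>n::nat. \<nu> (A n)) sums \<nu> (\<Union>n. A n))"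

definition variation :: "('a::topological_space set \<Rightarrow> 'b::real_normed_vector) \<Rightarrow> 'a set \<Rightarrow> ennreal" where
  "variation \<nu> E =
     (SUP A \<in> {A :: nat \<Rightarrow> 'a set. range A \<subseteq> sets borel \<and> disjoint_family A \<and> (\<Union>n. A n) = E}.
        \<Sum>n. ennreal (norm (\<nu> (A n))))"

definition total_variation :: "('a::topological_space set \<Rightarrow> 'b::real_normed_vector) \<Rightarrow> 'a measure" where
  "total_variation \<nu> = measure_of UNIV (sets borel) (variation \<nu>)"

lemma borel_vector_measure_sums:
  assumes "borel_vector_measure \<nu>" "range A \<subseteq> sets borel" "disjoint_family A"
  shows "(\<lambda>n::nat. \<nu> (A n)) sums \<nu> (\<Union>n. A n)"
  using assms by (auto simp: borel_vector_measure_def)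

lemma borel_vector_measure_empty:
  assumes "borel_vector_measure \<nu>" shows "\<nu> {} = 0"
proof -
  have "(\<lambda>n::nat. \<nu> {}) sums \<nu> (\<Union>n::nat. {})"
    by (rule borel_vector_measure_sums[OF assms]) (auto simp: disjoint_family_on_def)
  then have "(\<lambda>n::nat. \<nu> {}) \<longlonglongrightarrow> 0" by (intro summable_LIMSEQ_zero) (auto simp: sums_iff)
  then show ?thesis using LIMSEQ_const_iff by blast
qed

lemma borel_vector_measure_disjoint_union:
  assumes "borel_vector_measure \<nu>" "A \<in> sets borel" "B \<in> sets borel" "A \<inter> B = {}"
  shows "\<nu> (A \<union> B) = \<nu> A + \<nu> B"
proof -
  have "(\<lambda>n. \<nu> (binaryset A B n)) sums \<nu> (\<Union>n. binaryset A B n)"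
    using assms by (intro borel_vector_measure_sums)
      (auto simp: range_binaryset_eq disjoint_family_on_def binaryset_def)
  moreover have "(\<lambda>n. \<nu> (binaryset A B n)) sums (\<nu> A + \<nu> B)"
    by (intro binaryset_sums borel_vector_measure_empty assms)
  ultimately show ?thesis by (simp add: UN_binaryset_eq sums_iff)
qed

lemma borel_vector_measure_bounded_linear:
  assumes "borel_vector_measure \<nu>" "bounded_linear L"
  shows "borel_vector_measure (\<lambda>E. L (\<nu> E))"
  using assms unfolding borel_vector_measure_def by (auto intro: bounded_linear.sums)

lemma variation_upper:
  assumes "range A \<subseteq> sets borel" "disjoint_family A" "(\<Union>n. A n) = E"
  shows "(\<Sum>n::nat. ennreal (norm (\<nu> (A n)))) \<le> variation \<nu> E"
  unfolding variation_def using assms by (intro SUP_upper) auto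

lemma variation_least:
  assumes "\<And>A. range A \<subseteq> sets borel \<Longrightarrow> disjoint_family A \<Longrightarrow> (\<Union>n. A n) = E
     \<Longrightarrow> (\<Sum>n::nat. ennreal (norm (\<nu> (A n)))) \<le> c"
  shows "variation \<nu> E \<le> c"
  unfolding variation_def using assms by (intro SUP_least) auto

lemma variation_empty:
  assumes "borel_vector_measure \<nu>" shows "variation \<nu> {} = 0"
proof -
  have "variation \<nu> {} \<le> 0"
    by (rule variation_least) (auto simp: borel_vector_measure_empty[OF assms])
  then show ?thesis by simp
qed

lemma norm_le_variation:
  assumes "borel_vector_measure \<nu>" "E \<in> sets borel"
  shows "ennreal (norm (\<nu> E)) \<le> variation \<nu> E"
proof -
  have e: "\<nu> {} = 0" by (rule borel_vector_measure_empty[OF assms(1)])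
  have "(\<lambda>n. ennreal (norm (\<nu> (binaryset E {} n)))) sums
      (ennreal (norm (\<nu> E)) + ennreal (norm (\<nu> {})))"
    by (rule binaryset_sums) (simp add: e)
  then have "(\<Sum>n. ennreal (norm (\<nu> (binaryset E {} n)))) = ennreal (norm (\<nu> E))"
    by (simp add: sums_iff e)
  moreover have "(\<Sum>n. ennreal (norm (\<nu> (binaryset E {} n)))) \<le> variation \<nu> E"
    using assms by (intro variation_upper)
      (auto simp: range_binaryset_eq disjoint_family_on_def binaryset_def UN_binaryset_eq)
  ultimately show ?thesis by simp
qed

lemma ennreal_norm_sums_le:
  fixes f :: "nat \<Rightarrow> 'b::real_normed_vector"
  assumes "f sums s"
  shows "ennreal (norm s) \<le> (\<Sum>i. ennreal (norm (f i)))"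
proof (rule LIMSEQ_le_const2)
  show "(\<lambda>n. ennreal (norm (\<Sum>i<n. f i))) \<longlonglongrightarrow> ennreal (norm s)"
    using assms by (intro tendsto_ennrealI tendsto_norm) (simp add: sums_def)
  have "ennreal (norm (\<Sum>i<n. f i)) \<le> (\<Sum>i. ennreal (norm (f i)))" for n
  proof -
    have "ennreal (norm (\<Sum>i<n. f i)) \<le> ennreal (\<Sum>i<n. norm (f i))"
      by (intro ennreal_leI norm_sum)
    also have "\<dots> = (\<Sum>i<n. ennreal (norm (f i)))" by simp
    also have "\<dots> \<le> (\<Sum>i. ennreal (norm (f i)))" by (intro sum_le_suminf) auto
    finally show ?thesis .
  qed
  then show "\<exists>N. \<forall>n\<ge>N. ennreal (norm (\<Sum>i<n. f i)) \<le> (\<Sum>i. ennreal (norm (f i)))" by blast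
qed

lemma ennreal_suminf_swap:
  fixes f :: "nat \<Rightarrow> nat \<Rightarrow> ennreal"
  shows "(\<Sum>i. \<Sum>j. f i j) = (\<Sum>j. \<Sum>i. f i j)"
proof -
  have "(\<Sum>i. \<Sum>j. f i j) = (\<integral>\<^sup>+i. (\<Sum>j. f i j) \<partial>count_space UNIV)"
    by (simp add: nn_integral_count_space_nat)
  also have "\<dots> = (\<Sum>j. \<integral>\<^sup>+i. f i j \<partial>count_space UNIV)"
    by (intro nn_integral_suminf) auto
  also have "\<dots> = (\<Sum>j. \<Sum>i. f i j)"
    by (simp add: nn_integral_count_space_nat)
  finally show ?thesis .
qed

lemma variation_countably_subadditive:
  assumes \<nu>: "borel_vector_measure \<nu>" and E: "range E \<subseteq> sets borel" "disjoint_family E"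
  shows "variation \<nu> (\<Union>i::nat. E i) \<le> (\<Sum>i. variation \<nu> (E i))"
proof (rule variation_least)
  fix A :: "nat \<Rightarrow> 'a set"
  assume A: "range A \<subseteq> sets borel" "disjoint_family A" "(\<Union>n. A n) = (\<Union>i. E i)"
  have "ennreal (norm (\<nu> (A n))) \<le> (\<Sum>i. ennreal (norm (\<nu> (A n \<inter> E i))))" for n
  proof (rule ennreal_norm_sums_le)
    have "(\<lambda>i. \<nu> (A n \<inter> E i)) sums \<nu> (\<Union>i. A n \<inter> E i)"
    proof (rule borel_vector_measure_sums[OF \<nu>])
      show "range (\<lambda>i. A n \<inter> E i) \<subseteq> sets borel" using A(1) E(1) by auto
      show "disjoint_family (\<lambda>i. A n \<inter> E i)"
        using E(2) unfolding disjoint_family_on_def by blast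
    qed
    moreover have "(\<Union>i. A n \<inter> E i) = A n" using A(3) by blast
    ultimately show "(\<lambda>i. \<nu> (A n \<inter> E i)) sums \<nu> (A n)" by simp
  qed
  then have "(\<Sum>n. ennreal (norm (\<nu> (A n)))) \<le> (\<Sum>n. \<Sum>i. ennreal (norm (\<nu> (A n \<inter> E i))))"
    by (intro suminf_le) auto
  also have "\<dots> = (\<Sum>i. \<Sum>n. ennreal (norm (\<nu> (A n \<inter> E i))))" by (rule ennreal_suminf_swap)
  also have "\<dots> \<le> (\<Sum>i. variation \<nu> (E i))"
  proof (intro suminf_le variation_upper)
    fix i
    show "range (\<lambda>n. A n \<inter> E i) \<subseteq> sets borel" using A E by auto
    show "disjoint_family (\<lambda>n. A n \<inter> E i)"
      using A(2) unfolding disjoint_family_on_def by blast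
    show "(\<Union>n. A n \<inter> E i) = E i" using A(3) by blast
  qed auto
  finally show "(\<Sum>n. ennreal (norm (\<nu> (A n)))) \<le> (\<Sum>i. variation \<nu> (E i))" .
qed

lemma variation_countably_superadditive:
  fixes \<nu> :: "'a::topological_space set \<Rightarrow> 'b::real_normed_vector"
  assumes \<nu>: "borel_vector_measure \<nu>" and E: "range E \<subseteq> sets borel" "disjoint_family E"
  shows "(\<Sum>i. variation \<nu> (E i)) \<le> variation \<nu> (\<Union>i::nat. E i)"
proof -
  define P where "P i = {A :: nat \<Rightarrow> 'a set. range A \<subseteq> sets borel \<and> disjoint_family A \<and> (\<Union>n. A n) = E i}" for i
  define S where "S A = (\<Sum>n::nat. ennreal (norm (\<nu> (A n))))" for A
  have "\<exists>f::nat \<Rightarrow> ennreal. incseq f \<and> range f \<subseteq> S ` P i \<and> Sup (S ` P i) = (SUP k. f k)" for i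
  proof (rule ennreal_Sup_countable_SUP)
    have "binaryset (E i) {} \<in> P i" using E
      by (auto simp: P_def range_binaryset_eq disjoint_family_on_def binaryset_def UN_binaryset_eq)
    then show "S ` P i \<noteq> {}" by auto
  qed
  then obtain f where f: "\<And>i. incseq (f i)" "\<And>i. range (f i) \<subseteq> S ` P i"
      "\<And>i. Sup (S ` P i) = (SUP k::nat. f i k)"
    by metis
  have "\<exists>A. \<forall>i k. A i k \<in> P i \<and> f i k = S (A i k)" using f(2) by (intro choice allI) blast
  then obtain A where A: "\<And>i k. A i k \<in> P i" "\<And>i k. f i k = S (A i k)" by blast
  have var: "variation \<nu> (E i) = (SUP k. f i k)" for i
    using f(3)[of i] by (simp add: variation_def P_def S_def)
  have "(\<Sum>i. variation \<nu> (E i)) = (SUP k. \<Sum>i. f i k)"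
    unfolding var using f(1) by (intro ennreal_suminf_SUP_eq)
  also have "\<dots> \<le> variation \<nu> (\<Union>i. E i)"
  proof (rule SUP_least)
    fix k
    define B where "B m = (case prod_decode m of (i, n) \<Rightarrow> A i k n)" for m
    have "(\<Sum>m. (\<lambda>(i, n). ennreal (norm (\<nu> (A i k n)))) (prod_decode m)) = (\<Sum>i. f i k)"
      by (rule suminf_ennreal_2dimen) (simp only: A(2) S_def prod.case)
    moreover have "(\<lambda>(i, n). ennreal (norm (\<nu> (A i k n)))) (prod_decode m) = ennreal (norm (\<nu> (B m)))" for m
      unfolding B_def by (cases "prod_decode m") simp
    ultimately have "(\<Sum>m. ennreal (norm (\<nu> (B m)))) = (\<Sum>i. f i k)" by simp
    moreover have "(\<Sum>m. ennreal (norm (\<nu> (B m)))) \<le> variation \<nu> (\<Union>i. E i)"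
    proof (rule variation_upper)
      show "range B \<subseteq> sets borel" 
      proof (intro image_subsetI)
        fix m
        obtain i n where m: "prod_decode m = (i, n)" by force
        have "A i k n \<in> sets borel" using A(1)[of i k] by (auto simp: P_def)
        then show "B m \<in> sets borel" by (simp add: B_def m)
      qed
      have sub: "A i k n \<subseteq> E i" for i n using A(1)[of i k] by (auto simp: P_def)
      have disj: "A i k n \<inter> A i' k n' = {}" if "(i, n) \<noteq> (i', n')" for i n i' n'
      proof (cases "i = i'")
        case True
        then show ?thesis using that A(1)[of i k] by (auto simp: P_def disjoint_family_on_def)
      next
        case False
        then have "E i \<inter> E i' = {}" using E(2) by (auto simp: disjoint_family_on_def)
        then show ?thesis using sub[of i n] sub[of i' n'] by blast
      qed
      show "disjoint_family B"
        unfolding disjoint_family_on_def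
      proof (intro ballI impI)
        fix m m' :: nat assume "m \<noteq> m'"
        then have "prod_decode m \<noteq> prod_decode m'"
          by (metis prod_decode_inverse)
        then show "B m \<inter> B m' = {}"
          unfolding B_def case_prod_beta by (intro disj) simp
      qed
      show "(\<Union>m. B m) = (\<Union>i. E i)"
      proof
        show "(\<Union>m. B m) \<subseteq> (\<Union>i. E i)"
          unfolding B_def case_prod_beta using sub by blast
        show "(\<Union>i. E i) \<subseteq> (\<Union>m. B m)"
        proof
          fix x assume "x \<in> (\<Union>i. E i)"
          then obtain i where "x \<in> E i" by blast
          moreover have "(\<Union>n. A i k n) = E i" using A(1)[of i k] by (simp add: P_def)
          ultimately obtain n where "x \<in> A i k n" by blast
          then have "x \<in> B (prod_encode (i, n))" by (simp add: B_def)
          then show "x \<in> (\<Union>m. B m)" by blast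
        qed
      qed
    qed
    ultimately show "(\<Sum>i. f i k) \<le> variation \<nu> (\<Union>i. E i)" by simp
  qed
  finally show ?thesis .
qed

lemma sets_total_variation [simp, measurable_cong]: "sets (total_variation \<nu>) = sets borel"
  by (metis sets.sigma_sets_eq sets_measure_of space_borel subset_UNIV Pow_UNIV total_variation_def)

lemma space_total_variation [simp]: "space (total_variation \<nu>) = UNIV"
  by (simp add: total_variation_def space_measure_of_conv)

lemma emeasure_total_variation:
  assumes "borel_vector_measure \<nu>" "E \<in> sets borel"
  shows "emeasure (total_variation \<nu>) E = variation \<nu> E"
proof -
  have "sigma_algebra UNIV (sets (borel::'a measure))"
    by (metis sets.sigma_algebra_axioms space_borel)
  moreover have "positive (sets borel) (variation \<nu>)"
    by (simp add: positive_def variation_empty[OF assms(1)])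
  moreover have "countably_additive (sets borel) (variation \<nu>)"
    unfolding countably_additive_def
    by (auto intro!: antisym variation_countably_subadditive variation_countably_superadditive assms)
  ultimately show ?thesis
    unfolding total_variation_def using assms(2) by (intro emeasure_measure_of_sigma)
qed

lemma norm_le_total_variation:
  assumes "borel_vector_measure \<nu>" "E \<in> sets borel"
  shows "ennreal (norm (\<nu> E)) \<le> emeasure (total_variation \<nu>) E"
  by (simp add: emeasure_total_variation norm_le_variation assms)

lemma emeasure_total_variation_least:
  assumes "borel_vector_measure \<nu>" "E \<in> sets borel"
    "\<And>A. range A \<subseteq> sets borel \<Longrightarrow> disjoint_family A \<Longrightarrow> (\<Union>n. A n) = E
     \<Longrightarrow> (\<Sum>n::nat. ennreal (norm (\<nu> (A n)))) \<le> c"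
  shows "emeasure (total_variation \<nu>) E \<le> c"
  unfolding emeasure_total_variation[OF assms(1,2)] by (rule variation_least) (rule assms(3))

lemma total_variation_le_of_norm_le:
  assumes \<nu>: "borel_vector_measure \<nu>" and E: "E \<in> sets borel" and M: "sets M = sets borel"
    and le: "\<And>A. A \<in> sets borel \<Longrightarrow> A \<subseteq> E \<Longrightarrow> ennreal (norm (\<nu> A)) \<le> emeasure M A"
  shows "emeasure (total_variation \<nu>) E \<le> emeasure M E"
proof (rule emeasure_total_variation_least[OF \<nu> E])
  fix A :: "nat \<Rightarrow> 'a set"
  assume A: "range A \<subseteq> sets borel" "disjoint_family A" "(\<Union>n. A n) = E"
  have "(\<Sum>n. ennreal (norm (\<nu> (A n)))) \<le> (\<Sum>n. emeasure M (A n))"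
    using A by (intro suminf_le le) auto
  also have "\<dots> = emeasure M E" using A M by (subst suminf_emeasure) auto
  finally show "(\<Sum>n. ennreal (norm (\<nu> (A n)))) \<le> emeasure M E" .
qed

lemma variation_add_le:
  assumes "borel_vector_measure \<mu>" "borel_vector_measure \<nu>"
  shows "variation (\<lambda>E. \<mu> E + \<nu> E) E \<le> variation \<mu> E + variation \<nu> E"
proof (rule variation_least)
  fix A :: "nat \<Rightarrow> 'a set"
  assume A: "range A \<subseteq> sets borel" "disjoint_family A" "(\<Union>n. A n) = E"
  have "(\<Sum>n. ennreal (norm (\<mu> (A n) + \<nu> (A n))))
      \<le> (\<Sum>n. ennreal (norm (\<mu> (A n))) + ennreal (norm (\<nu> (A n))))"
    by (intro suminf_le) (auto simp flip: ennreal_plus intro!: ennreal_leI norm_triangle_ineq)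
  also have "\<dots> = (\<Sum>n. ennreal (norm (\<mu> (A n)))) + (\<Sum>n. ennreal (norm (\<nu> (A n))))"
    by (intro suminf_add[symmetric]) auto
  also have "\<dots> \<le> variation \<mu> E + variation \<nu> E"
    using A by (intro add_mono variation_upper)
  finally show "(\<Sum>n. ennreal (norm (\<mu> (A n) + \<nu> (A n)))) \<le> variation \<mu> E + variation \<nu> E" .
qed

lemma variation_scaleR:
  "variation (\<lambda>E. c *\<^sub>R \<mu> E) E = ennreal \<bar>c\<bar> * variation \<mu> E"
  unfolding variation_def
  by (subst SUP_mult_left_ennreal) (simp add: ennreal_mult)

lemma borel_vector_measure_zero: "borel_vector_measure (\<lambda>_. 0)"
  by (simp add: borel_vector_measure_def)

lemma borel_vector_measure_add:
  "borel_vector_measure \<mu> \<Longrightarrow> borel_vector_measure \<nu> \<Longrightarrow> borel_vector_measure (\<lambda>E. \<mu> E + \<nu> E)"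
  unfolding borel_vector_measure_def by (auto intro: sums_add)

lemma borel_vector_measure_scaleR:
  "borel_vector_measure \<mu> \<Longrightarrow> borel_vector_measure (\<lambda>E. c *\<^sub>R \<mu> E)"
  unfolding borel_vector_measure_def by (auto intro: sums_scaleR_right)

lemma variation_zero: "variation (\<lambda>_. 0) E = 0"
proof -
  have "variation (\<lambda>_. 0::'b) E \<le> 0" by (rule variation_least) simp
  then show ?thesis by simp
qed


section \<open>The Banach space of complex Radon measures\<close>

definition regular_borel_measure :: "'a::topological_space measure \<Rightarrow> bool" where
  "regular_borel_measure M \<longleftrightarrow>
     (\<forall>E\<in>sets borel.
        emeasure M E = (INF U \<in> {U. open U \<and> E \<subseteq> U}. emeasure M U) \<and>
        emeasure M E = (SUP K \<in> {K. compact K \<and> K \<subseteq> E}. emeasure M K))"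

lemma regular_borel_measure_iff:
  fixes M :: "'a::t2_space measure"
  assumes sets: "sets M = sets borel" and fin: "emeasure M UNIV < \<infinity>"
  shows "regular_borel_measure M \<longleftrightarrow>
    (\<forall>E\<in>sets borel. \<forall>e>0. \<exists>K. compact K \<and> K \<subseteq> E \<and> emeasure M (E - K) < ennreal e)"
proof -
  have finE: "emeasure M E < \<infinity>" for E
    by (metis emeasure_space fin infinity_ennreal_def le_less_trans sets sets_eq_imp_space_eq space_borel)
  have diff: "emeasure M (E - K) = emeasure M E - emeasure M K"
    if "E \<in> sets borel" "compact K" "K \<subseteq> E" for E K
    using that finE[of K] by (intro emeasure_Diff) (auto simp: sets compact_imp_closed)
  show ?thesis
  proof (intro iffI ballI allI impI)
    fix E :: "'a set" and e :: real
    assume M: "regular_borel_measure M" and E: "E \<in> sets borel" and e: "0 < e"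
    have sup: "emeasure M E = (SUP K \<in> {K. compact K \<and> K \<subseteq> E}. emeasure M K)"
      using M E unfolding regular_borel_measure_def by blast
    show "\<exists>K. compact K \<and> K \<subseteq> E \<and> emeasure M (E - K) < ennreal e"
    proof (cases "emeasure M E = 0")
      case True
      then show ?thesis using e by (intro exI[of _ "{}"]) auto
    next
      case False
      have "emeasure M E - ennreal e < emeasure M E"
        using False e finE[of E] by (intro ennreal_between) (auto simp: zero_less_iff_neq_zero)
      then obtain K where K: "compact K" "K \<subseteq> E" "emeasure M E - ennreal e < emeasure M K"
        unfolding sup less_SUP_iff by auto
      have "emeasure M E - emeasure M K < ennreal e"
      proof (cases "emeasure M E" "emeasure M K" rule: ennreal2_cases)
        case (real_real r s)
        have "r - e < s"
        proof (rule ccontr)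
          assume "\<not> r - e < s"
          then have "ennreal s \<le> ennreal (r - e)" by (intro ennreal_leI) simp
          with K(3) real_real e show False by (simp add: ennreal_minus leD)
        qed
        with real_real e show ?thesis by (simp add: ennreal_minus ennreal_lessI)
      qed (use finE[of E] finE[of K] in auto)
      then show ?thesis using K diff[OF E K(1,2)] by auto
    qed
  next
    assume *: "\<forall>E\<in>sets borel. \<forall>e>0. \<exists>K. compact K \<and> K \<subseteq> E \<and> emeasure M (E - K) < ennreal e"
    show "regular_borel_measure M"
      unfolding regular_borel_measure_def
    proof (intro ballI conjI antisym)
      fix E :: "'a set" assume E: "E \<in> sets borel"
      show "emeasure M E \<le> (INF U \<in> {U. open U \<and> E \<subseteq> U}. emeasure M U)"
        using sets by (intro INF_greatest emeasure_mono) auto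
      show "(INF U \<in> {U. open U \<and> E \<subseteq> U}. emeasure M U) \<le> emeasure M E"
      proof (rule ennreal_le_epsilon)
        fix e :: real assume "0 < e"
        moreover have "- E \<in> sets borel" using E by auto
        ultimately obtain K where K: "compact K" "K \<subseteq> - E" "emeasure M (- E - K) < ennreal e"
          using * by blast
        have "(INF U \<in> {U. open U \<and> E \<subseteq> U}. emeasure M U) \<le> emeasure M (- K)"
          using K by (intro INF_lower) (auto simp: compact_imp_closed)
        also have "- K = E \<union> (- E - K)" using K(2) by auto
        also have "emeasure M (E \<union> (- E - K)) \<le> emeasure M E + emeasure M (- E - K)"
          using E K(1) by (intro emeasure_subadditive) (auto simp: sets compact_imp_closed)
        also have "\<dots> \<le> emeasure M E + ennreal e" using K(3) by (intro add_mono) auto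
        finally show "(INF U \<in> {U. open U \<and> E \<subseteq> U}. emeasure M U) \<le> emeasure M E + ennreal e" .
      qed
      show "(SUP K \<in> {K. compact K \<and> K \<subseteq> E}. emeasure M K) \<le> emeasure M E"
        using sets E by (intro SUP_least emeasure_mono) auto
      show "emeasure M E \<le> (SUP K \<in> {K. compact K \<and> K \<subseteq> E}. emeasure M K)"
      proof (rule ennreal_le_epsilon)
        fix e :: real assume "0 < e"
        then obtain K where K: "compact K" "K \<subseteq> E" "emeasure M (E - K) < ennreal e"
          using * E by blast
        have "E = K \<union> (E - K)" using K(2) by auto
        then have "emeasure M E \<le> emeasure M K + emeasure M (E - K)"
          using E K(1) emeasure_subadditive[of K M "E - K"] by (auto simp: sets compact_imp_closed)
        also have "\<dots> \<le> (SUP K \<in> {K. compact K \<and> K \<subseteq> E}. emeasure M K) + ennreal e"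
          using K by (intro add_mono SUP_upper) auto
        finally show "emeasure M E \<le> (SUP K \<in> {K. compact K \<and> K \<subseteq> E}. emeasure M K) + ennreal e" .
      qed
    qed
  qed
qed

definition complex_radon_measures :: "('a::t2_space set \<Rightarrow> complex) set" where
  "complex_radon_measures =
     {\<mu>. borel_vector_measure \<mu> \<and> (\<forall>E. E \<notin> sets borel \<longrightarrow> \<mu> E = 0) \<and>
         emeasure (total_variation \<mu>) UNIV < \<infinity> \<and> regular_borel_measure (total_variation \<mu>)}"

lemma complex_radon_measuresI:
  assumes "borel_vector_measure \<mu>" "\<And>E. E \<notin> sets borel \<Longrightarrow> \<mu> E = 0" "variation \<mu> UNIV < \<infinity>"
    "\<And>E e. E \<in> sets borel \<Longrightarrow> 0 < e \<Longrightarrow> \<exists>K. compact K \<and> K \<subseteq> E \<and> variation \<mu> (E - K) < ennreal e"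
  shows "\<mu> \<in> complex_radon_measures"
proof -
  have "emeasure (total_variation \<mu>) UNIV < \<infinity>"
    using assms by (simp add: emeasure_total_variation)
  moreover from this have "regular_borel_measure (total_variation \<mu>)"
    using assms(1,4)
    by (subst regular_borel_measure_iff)
       (auto simp: emeasure_total_variation compact_imp_closed cong: conj_cong)
  ultimately show ?thesis using assms(1,2) by (auto simp: complex_radon_measures_def)
qed

lemma complex_radon_measuresD:
  assumes "\<mu> \<in> complex_radon_measures"
  shows "borel_vector_measure \<mu>" "E \<notin> sets borel \<Longrightarrow> \<mu> E = 0" "variation \<mu> UNIV < \<infinity>"
    "E \<in> sets borel \<Longrightarrow> 0 < e \<Longrightarrow> \<exists>K. compact K \<and> K \<subseteq> E \<and> variation \<mu> (E - K) < ennreal e"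
proof -
  show \<mu>: "borel_vector_measure \<mu>" and "E \<notin> sets borel \<Longrightarrow> \<mu> E = 0"
    using assms by (auto simp: complex_radon_measures_def)
  have fin: "emeasure (total_variation \<mu>) UNIV < \<infinity>"
    using assms by (auto simp: complex_radon_measures_def)
  with \<mu> show "variation \<mu> UNIV < \<infinity>" by (simp add: emeasure_total_variation)
  assume E: "E \<in> sets borel" "0 < e"
  have "regular_borel_measure (total_variation \<mu>)"
    using assms by (auto simp: complex_radon_measures_def)
  with E obtain K where "compact K" "K \<subseteq> E" "emeasure (total_variation \<mu>) (E - K) < ennreal e"
    using regular_borel_measure_iff[OF sets_total_variation fin] by blast
  with E \<mu> show "\<exists>K. compact K \<and> K \<subseteq> E \<and> variation \<mu> (E - K) < ennreal e"
    by (auto simp: emeasure_total_variation compact_imp_closed)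
qed

lemma variation_mono:
  assumes "borel_vector_measure \<mu>" "E \<in> sets borel" "F \<in> sets borel" "E \<subseteq> F"
  shows "variation \<mu> E \<le> variation \<mu> F"
  using emeasure_mono[of E F "total_variation \<mu>"] assms by (simp add: emeasure_total_variation)

lemma complex_radon_measures_zero: "(\<lambda>_. 0) \<in> complex_radon_measures"
  by (rule complex_radon_measuresI) (auto simp: borel_vector_measure_zero variation_zero)

lemma complex_radon_measures_add:
  assumes \<mu>: "\<mu> \<in> complex_radon_measures" and \<nu>: "\<nu> \<in> complex_radon_measures"
  shows "(\<lambda>E. \<mu> E + \<nu> E) \<in> complex_radon_measures"
proof (rule complex_radon_measuresI)
  note bvm = complex_radon_measuresD(1)[OF \<mu>] complex_radon_measuresD(1)[OF \<nu>]
  show "borel_vector_measure (\<lambda>E. \<mu> E + \<nu> E)" using bvm by (rule borel_vector_measure_add)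
  show "\<mu> E + \<nu> E = 0" if "E \<notin> sets borel" for E
    using complex_radon_measuresD(2)[OF \<mu> that] complex_radon_measuresD(2)[OF \<nu> that] by simp
  show "variation (\<lambda>E. \<mu> E + \<nu> E) UNIV < \<infinity>"
    using variation_add_le[OF bvm, of UNIV] complex_radon_measuresD(3)[OF \<mu>]
      complex_radon_measuresD(3)[OF \<nu>]
    by (simp add: ennreal_add_less_top le_less_trans)
  fix E :: "'a set" and e :: real assume E: "E \<in> sets borel" and e: "0 < e"
  obtain K where K: "compact K" "K \<subseteq> E" "variation \<mu> (E - K) < ennreal (e/2)"
    using complex_radon_measuresD(4)[OF \<mu> E, of "e/2"] e by auto
  obtain L where L: "compact L" "L \<subseteq> E" "variation \<nu> (E - L) < ennreal (e/2)"
    using complex_radon_measuresD(4)[OF \<nu> E, of "e/2"] e by auto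
  have "variation (\<lambda>E. \<mu> E + \<nu> E) (E - (K \<union> L))
      \<le> variation \<mu> (E - (K \<union> L)) + variation \<nu> (E - (K \<union> L))"
    by (rule variation_add_le[OF bvm])
  also have "\<dots> \<le> variation \<mu> (E - K) + variation \<nu> (E - L)"
    using E K(1) L(1) by (intro add_mono variation_mono bvm) (auto simp: compact_imp_closed)
  also have "\<dots> < ennreal (e/2) + ennreal (e/2)" using K(3) L(3) by (rule add_strict_mono)
  also have "\<dots> = ennreal e" using e by (simp flip: ennreal_plus)
  finally show "\<exists>K. compact K \<and> K \<subseteq> E \<and> variation (\<lambda>E. \<mu> E + \<nu> E) (E - K) < ennreal e"
    using K L by (intro exI[of _ "K \<union> L"]) (auto intro: compact_Un)
qed

lemma complex_radon_measures_dominated: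
  fixes \<mu> \<nu> :: "'a::t2_space set \<Rightarrow> complex" and h :: "'a \<Rightarrow> 'a"
  assumes \<mu>: "\<mu> \<in> complex_radon_measures" and \<nu>: "borel_vector_measure \<nu>"
    and null: "\<And>E. E \<notin> sets borel \<Longrightarrow> \<nu> E = 0"
    and h: "\<And>K. compact K \<Longrightarrow> compact (h ` K)" "\<And>E. E \<in> sets borel \<Longrightarrow> h -` E \<in> sets borel"
    and le: "\<And>E. E \<in> sets borel \<Longrightarrow> variation \<nu> E \<le> ennreal c * variation \<mu> (h -` E)"
  shows "\<nu> \<in> complex_radon_measures"
proof (rule complex_radon_measuresI[OF \<nu> null])
  note bvm = complex_radon_measuresD(1)[OF \<mu>]
  show "variation \<nu> UNIV < \<infinity>"
    using le[of UNIV] complex_radon_measuresD(3)[OF \<mu>]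
    by (auto simp: ennreal_mult_less_top intro: le_less_trans)
  fix E :: "'a set" and e :: real assume E: "E \<in> sets borel" and e: "0 < e"
  define d where "d = e / (\<bar>c\<bar> + 1)"
  have d: "0 < d" using e by (simp add: d_def)
  obtain K where K: "compact K" "K \<subseteq> h -` E" "variation \<mu> (h -` E - K) < ennreal d"
    using complex_radon_measuresD(4)[OF \<mu> h(2)[OF E] d] by auto
  have hK: "compact (h ` K)" by (rule h(1)[OF K(1)])
  have meas: "E - h ` K \<in> sets borel" using E hK by (auto simp: compact_imp_closed)
  have "variation \<nu> (E - h ` K) \<le> ennreal c * variation \<mu> (h -` (E - h ` K))"
    by (rule le[OF meas])
  also have "\<dots> \<le> ennreal c * variation \<mu> (h -` E - K)"
    using K(1) h(2) E meas by (intro mult_left_mono variation_mono bvm) (auto simp: compact_imp_closed)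
  also have "\<dots> \<le> ennreal \<bar>c\<bar> * ennreal d"
    using K(3) by (intro mult_mono ennreal_leI) auto
  also have "\<dots> = ennreal (\<bar>c\<bar> * d)" using d by (simp add: ennreal_mult)
  also have "\<dots> < ennreal e" using e by (intro ennreal_lessI) (auto simp: d_def field_simps)
  finally show "\<exists>K. compact K \<and> K \<subseteq> E \<and> variation \<nu> (E - K) < ennreal e"
    using K hK by (intro exI[of _ "h ` K"]) auto
qed

lemma complex_radon_measures_scaleR:
  assumes \<mu>: "\<mu> \<in> complex_radon_measures"
  shows "(\<lambda>E. c *\<^sub>R \<mu> E) \<in> complex_radon_measures"
  by (rule complex_radon_measures_dominated[OF \<mu>, where h = id and c = "\<bar>c\<bar>"])
     (auto simp: variation_scaleR complex_radon_measuresD[OF \<mu>]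
       intro!: borel_vector_measure_scaleR)

text \<open>
  This is \<open>M(\<Omega>)\<close> for \<open>\<Omega> = UNIV :: 'a set\<close>: a regular complex Borel measure is one whose total
  variation is regular.  A complex Borel measure automatically has finite total variation; the
  explicit requirement merely makes the norm available.  Values at non-Borel sets are normalised
  to \<open>0\<close> so that equality of measures is equality of functions.
\<close>

typedef (overloaded) 'a complex_radon_measure =
  "complex_radon_measures :: ('a::t2_space set \<Rightarrow> complex) set"
  morphisms set_fun Complex_Radon_Measure
  using complex_radon_measures_zero by blast

setup_lifting type_definition_complex_radon_measure

lemma complex_radon_measure_eqI:
  assumes "\<And>E. E \<in> sets borel \<Longrightarrow> set_fun \<mu> E = set_fun \<nu> E"
  shows "\<mu> = \<nu>"
proof -
  have "set_fun \<mu> E = set_fun \<nu> E" for E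
  proof (cases "E \<in> sets borel")
    case False
    then show ?thesis
      using complex_radon_measuresD(2)[OF set_fun, of E \<mu>] complex_radon_measuresD(2)[OF set_fun, of E \<nu>]
      by simp
  qed (rule assms)
  then show ?thesis by (auto simp flip: set_fun_inject)
qed

definition abs_measure :: "'a::t2_space complex_radon_measure \<Rightarrow> 'a measure" where
  "abs_measure \<mu> = total_variation (set_fun \<mu>)"

lemma borel_vector_measure_set_fun: "borel_vector_measure (set_fun \<mu>)"
  by (rule complex_radon_measuresD[OF set_fun])

lemma sets_abs_measure [simp, measurable_cong]: "sets (abs_measure \<mu>) = sets borel"
  by (simp add: abs_measure_def)

lemma space_abs_measure [simp]: "space (abs_measure \<mu>) = UNIV"
  by (simp add: abs_measure_def)

lemma emeasure_abs_measure:
  "E \<in> sets borel \<Longrightarrow> emeasure (abs_measure \<mu>) E = variation (set_fun \<mu>) E"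
  by (simp add: abs_measure_def emeasure_total_variation borel_vector_measure_set_fun)

lemma finite_measure_abs_measure: "finite_measure (abs_measure \<mu>)"
  using complex_radon_measuresD(3)[OF set_fun, of \<mu>]
  by (intro finite_measureI) (simp add: emeasure_abs_measure)

lemma norm_set_fun_le:
  assumes "E \<in> sets borel" shows "norm (set_fun \<mu> E) \<le> measure (abs_measure \<mu>) E"
proof -
  interpret finite_measure "abs_measure \<mu>" by (rule finite_measure_abs_measure)
  have "ennreal (norm (set_fun \<mu> E)) \<le> ennreal (measure (abs_measure \<mu>) E)"
    using norm_le_variation[OF borel_vector_measure_set_fun assms, of \<mu>] assms
    by (simp add: emeasure_abs_measure flip: emeasure_eq_measure)
  then show ?thesis by simp
qed

instantiation complex_radon_measure :: (t2_space) real_vector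
begin

lift_definition zero_complex_radon_measure :: "'a complex_radon_measure" is "\<lambda>_. 0"
  by (rule complex_radon_measures_zero)

lift_definition plus_complex_radon_measure ::
  "'a complex_radon_measure \<Rightarrow> 'a complex_radon_measure \<Rightarrow> 'a complex_radon_measure"
  is "\<lambda>\<mu> \<nu> E. \<mu> E + \<nu> E"
  by (rule complex_radon_measures_add)

lift_definition scaleR_complex_radon_measure ::
  "real \<Rightarrow> 'a complex_radon_measure \<Rightarrow> 'a complex_radon_measure"
  is "\<lambda>c \<mu> E. c *\<^sub>R \<mu> E"
  by (rule complex_radon_measures_scaleR)

definition uminus_complex_radon_measure :: "'a complex_radon_measure \<Rightarrow> 'a complex_radon_measure"
  where "- \<mu> = (-1) *\<^sub>R \<mu>" for \<mu> :: "'a complex_radon_measure"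

definition minus_complex_radon_measure ::
  "'a complex_radon_measure \<Rightarrow> 'a complex_radon_measure \<Rightarrow> 'a complex_radon_measure"
  where "\<mu> - \<nu> = \<mu> + (-1) *\<^sub>R \<nu>" for \<mu> :: "'a complex_radon_measure"

instance
  by standard
    (unfold uminus_complex_radon_measure_def minus_complex_radon_measure_def,
     (transfer, simp add: algebra_simps scaleR_add_left scaleR_add_right)+)

end

lemma set_fun_simps [simp]:
  "set_fun 0 E = 0"
  "set_fun (\<mu> + \<nu>) E = set_fun \<mu> E + set_fun \<nu> E"
  "set_fun (c *\<^sub>R \<mu>) E = c *\<^sub>R set_fun \<mu> E"
  "set_fun (- \<mu>) E = - set_fun \<mu> E"
  "set_fun (\<mu> - \<nu>) E = set_fun \<mu> E - set_fun \<nu> E"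
  unfolding uminus_complex_radon_measure_def minus_complex_radon_measure_def
  by (transfer; simp)+

instantiation complex_radon_measure :: (t2_space) real_normed_vector
begin

definition norm_complex_radon_measure :: "'a complex_radon_measure \<Rightarrow> real"
  where "norm \<mu> = measure (abs_measure \<mu>) UNIV"

definition dist_complex_radon_measure ::
  "'a complex_radon_measure \<Rightarrow> 'a complex_radon_measure \<Rightarrow> real"
  where "dist \<mu> \<nu> = norm (\<mu> - \<nu>)" for \<mu> :: "'a complex_radon_measure"

definition sgn_complex_radon_measure :: "'a complex_radon_measure \<Rightarrow> 'a complex_radon_measure"
  where "sgn \<mu> = \<mu> /\<^sub>R norm \<mu>" for \<mu> :: "'a complex_radon_measure"

definition uniformity_complex_radon_measure ::
  "('a complex_radon_measure \<times> 'a complex_radon_measure) filter"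
  where "uniformity_complex_radon_measure = (INF e\<in>{0<..}. principal {(x, y). dist x y < e})"

definition open_complex_radon_measure :: "'a complex_radon_measure set \<Rightarrow> bool"
  where "open_complex_radon_measure U =
    (\<forall>x\<in>U. eventually (\<lambda>(x', y). x' = x \<longrightarrow> y \<in> U) uniformity)"

lemma ennreal_norm_complex_radon_measure:
  "ennreal (norm \<mu>) = variation (set_fun \<mu>) UNIV" for \<mu> :: "'a complex_radon_measure"
proof -
  interpret finite_measure "abs_measure \<mu>" by (rule finite_measure_abs_measure)
  show ?thesis
    by (simp add: norm_complex_radon_measure_def emeasure_abs_measure flip: emeasure_eq_measure)
qed

instance
proof
  fix \<mu> \<nu> :: "'a complex_radon_measure" and c :: real and U :: "'a complex_radon_measure set"
  show "(norm \<mu> = 0) = (\<mu> = 0)"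
  proof
    assume n: "norm \<mu> = 0"
    interpret finite_measure "abs_measure \<mu>" by (rule finite_measure_abs_measure)
    show "\<mu> = 0"
    proof (rule complex_radon_measure_eqI)
      fix E :: "'a set" assume "E \<in> sets borel"
      then have "norm (set_fun \<mu> E) \<le> measure (abs_measure \<mu>) E" by (rule norm_set_fun_le)
      also have "\<dots> \<le> norm \<mu>"
        unfolding norm_complex_radon_measure_def using bounded_measure[of E] by simp
      finally show "set_fun \<mu> E = set_fun 0 E" using n by simp
    qed
  next
    assume "\<mu> = 0"
    then have "ennreal (norm \<mu>) = 0"
      unfolding ennreal_norm_complex_radon_measure
      by (simp add: zero_complex_radon_measure.rep_eq variation_zero)
    then show "norm \<mu> = 0" by (simp add: norm_complex_radon_measure_def)
  qed
  have "ennreal (norm (\<mu> + \<nu>)) \<le> ennreal (norm \<mu>) + ennreal (norm \<nu>)"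
    unfolding ennreal_norm_complex_radon_measure plus_complex_radon_measure.rep_eq
    by (intro variation_add_le borel_vector_measure_set_fun)
  then show "norm (\<mu> + \<nu>) \<le> norm \<mu> + norm \<nu>"
    by (simp add: norm_complex_radon_measure_def flip: ennreal_plus)
  have "ennreal (norm (c *\<^sub>R \<mu>)) = ennreal (\<bar>c\<bar> * norm \<mu>)"
    unfolding ennreal_mult[OF abs_ge_zero, of "norm \<mu>" c, simplified norm_complex_radon_measure_def, OF measure_nonneg, folded norm_complex_radon_measure_def]
      ennreal_norm_complex_radon_measure scaleR_complex_radon_measure.rep_eq
    by (rule variation_scaleR)
  then show "norm (c *\<^sub>R \<mu>) = \<bar>c\<bar> * norm \<mu>"
    by (simp add: norm_complex_radon_measure_def)
qed (simp_all add: dist_complex_radon_measure_def sgn_complex_radon_measure_def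
      uniformity_complex_radon_measure_def open_complex_radon_measure_def)

end

instance complex_radon_measure :: (t2_space) banach
proof
  fix X :: "nat \<Rightarrow> 'a complex_radon_measure"
  assume X: "Cauchy X"
  have le_norm: "norm (set_fun \<mu> E) \<le> norm \<mu>" if "E \<in> sets borel"
    for \<mu> :: "'a complex_radon_measure" and E
  proof -
    interpret finite_measure "abs_measure \<mu>" by (rule finite_measure_abs_measure)
    show ?thesis
      using norm_set_fun_le[OF that, of \<mu>] bounded_measure[of E]
      by (simp add: norm_complex_radon_measure_def)
  qed
  have out: "set_fun \<mu> E = 0" if "E \<notin> sets borel" for \<mu> :: "'a complex_radon_measure" and E
    using complex_radon_measuresD(2)[OF set_fun that] .
  have "Cauchy (\<lambda>n. set_fun (X n) E)" for E
  proof (cases "E \<in> sets borel")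
    case True
    show ?thesis
    proof (rule CauchyI)
      fix e :: real assume "0 < e"
      then obtain M where M: "\<And>m n. m \<ge> M \<Longrightarrow> n \<ge> M \<Longrightarrow> norm (X m - X n) < e"
        using CauchyD[OF X] by blast
      show "\<exists>M. \<forall>m\<ge>M. \<forall>n\<ge>M. norm (set_fun (X m) E - set_fun (X n) E) < e"
      proof (intro exI allI impI)
        fix m n assume "M \<le> m" "M \<le> n"
        then show "norm (set_fun (X m) E - set_fun (X n) E) < e"
          using M[of m n] le_norm[OF True, of "X m - X n"] by simp
      qed
    qed
  qed (simp add: out Cauchy_def)
  then have "\<exists>L. (\<lambda>n. set_fun (X n) E) \<longlonglongrightarrow> L" for E
    by (simp add: Cauchy_convergent_iff convergent_def)
  then obtain L where L: "\<And>E. (\<lambda>n. set_fun (X n) E) \<longlonglongrightarrow> L E" by metis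
  have var_le: "\<exists>M. \<forall>n\<ge>M. variation (\<lambda>E. L E - set_fun (X n) E) UNIV \<le> ennreal e" if e: "0 < e" for e
  proof -
    obtain M where M: "\<And>m n. m \<ge> M \<Longrightarrow> n \<ge> M \<Longrightarrow> norm (X m - X n) < e"
      using CauchyD[OF X e] by blast
    have "variation (\<lambda>E. L E - set_fun (X n) E) UNIV \<le> ennreal e" if n: "n \<ge> M" for n
    proof (rule variation_least)
      fix A :: "nat \<Rightarrow> 'a set"
      assume A: "range A \<subseteq> sets borel" "disjoint_family A" "(\<Union>n. A n) = UNIV"
      have "(\<Sum>i<N. norm (L (A i) - set_fun (X n) (A i))) \<le> e" for N
      proof (rule LIMSEQ_le_const2)
        show "(\<lambda>m. \<Sum>i<N. norm (set_fun (X m) (A i) - set_fun (X n) (A i)))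
            \<longlonglongrightarrow> (\<Sum>i<N. norm (L (A i) - set_fun (X n) (A i)))"
          by (intro tendsto_intros L)
        have "(\<Sum>i<N. norm (set_fun (X m) (A i) - set_fun (X n) (A i))) \<le> e" if m: "m \<ge> M" for m
        proof -
          have "ennreal (\<Sum>i<N. norm (set_fun (X m) (A i) - set_fun (X n) (A i)))
              = (\<Sum>i<N. ennreal (norm (set_fun (X m - X n) (A i))))" by simp
          also have "\<dots> \<le> (\<Sum>i. ennreal (norm (set_fun (X m - X n) (A i))))"
            by (intro sum_le_suminf) auto
          also have "\<dots> \<le> variation (set_fun (X m - X n)) UNIV"
            by (rule variation_upper) (use A in auto)
          also have "\<dots> = ennreal (norm (X m - X n))"
            by (simp add: ennreal_norm_complex_radon_measure)
          also have "\<dots> \<le> ennreal e" using M[OF m n] by (intro ennreal_leI) simp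
          finally show ?thesis using e by simp
        qed
        then show "\<exists>K. \<forall>m\<ge>K. (\<Sum>i<N. norm (set_fun (X m) (A i) - set_fun (X n) (A i))) \<le> e"
          by blast
      qed
      then have "(\<Sum>i<N. ennreal (norm (L (A i) - set_fun (X n) (A i)))) \<le> ennreal e" for N
        by (simp add: ennreal_leI)
      then show "(\<Sum>i. ennreal (norm (L (A i) - set_fun (X n) (A i)))) \<le> ennreal e"
        by (intro suminf_le_const summableI)
    qed
    then show ?thesis by (intro exI[of _ M] allI impI)
  qed
  have diff: "norm (L E - set_fun (X n) E) \<le> e"
    if "variation (\<lambda>E. L E - set_fun (X n) E) UNIV \<le> ennreal e" "E \<in> sets borel" "0 < e" for E n e
  proof -
    define f where "f i = ennreal (norm (L (binaryset E (- E) i) - set_fun (X n) (binaryset E (- E) i)))" for i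
    have "f 0 \<le> (\<Sum>i. f i)"
      using sum_le_suminf[of f "{0}"] by (simp)
    also have "\<dots> \<le> variation (\<lambda>E. L E - set_fun (X n) E) UNIV"
      unfolding f_def by (rule variation_upper)
        (use that(2) in \<open>auto simp: range_binaryset_eq disjoint_family_on_def binaryset_def UN_binaryset_eq\<close>)
    also note that(1)
    finally have "ennreal (norm (L E - set_fun (X n) E)) \<le> ennreal e"
      by (simp add: f_def binaryset_def)
    then show ?thesis using that(3) by simp
  qed
  have bvm: "borel_vector_measure L"
    unfolding borel_vector_measure_def
  proof (intro allI impI)
    fix A :: "nat \<Rightarrow> 'a set"
    assume A: "range A \<subseteq> sets borel" "disjoint_family A"
    have fin: "finite S \<Longrightarrow> set_fun \<mu> (\<Union>i\<in>S. A i) = (\<Sum>i\<in>S. set_fun \<mu> (A i))"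
      for S and \<mu> :: "'a complex_radon_measure"
    proof (induction S rule: finite_induct)
      case empty
      show ?case by (simp add: borel_vector_measure_empty[OF borel_vector_measure_set_fun])
    next
      case (insert i S)
      have "set_fun \<mu> (A i \<union> (\<Union>i\<in>S. A i)) = set_fun \<mu> (A i) + set_fun \<mu> (\<Union>i\<in>S. A i)"
      proof (rule borel_vector_measure_disjoint_union[OF borel_vector_measure_set_fun])
        have "A i \<inter> A j = {}" if "j \<in> S" for j
        proof -
          have "i \<noteq> j" using insert(2) that by metis
          then show ?thesis by (intro disjoint_family_onD[OF A(2)]) auto
        qed
        then show "A i \<inter> (\<Union>i\<in>S. A i) = {}" by blast
        show "A i \<in> sets borel" using A(1) by blast
        show "(\<Union>i\<in>S. A i) \<in> sets borel" using A(1) insert(1) by (intro sets.finite_UN) blast+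
      qed
      then show ?case using insert by simp
    qed
    have finL: "L (\<Union>i<N. A i) = (\<Sum>i<N. L (A i))" for N
    proof (rule LIMSEQ_unique[OF L])
      show "(\<lambda>n. set_fun (X n) (\<Union>i<N. A i)) \<longlonglongrightarrow> (\<Sum>i<N. L (A i))"
        unfolding fin[OF finite_lessThan] by (intro tendsto_intros L)
    qed
    show "(\<lambda>n. L (A n)) sums L (\<Union>n. A n)"
      unfolding sums_def
    proof (rule LIMSEQ_I)
      fix e :: real assume e: "0 < e"
      then obtain n where n: "variation (\<lambda>E. L E - set_fun (X n) E) UNIV \<le> ennreal (e/4)"
        using var_le[of "e/4"] by auto
      have "(\<lambda>N. \<Sum>i<N. set_fun (X n) (A i)) \<longlonglongrightarrow> set_fun (X n) (\<Union>i. A i)"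
        using borel_vector_measure_sums[OF borel_vector_measure_set_fun A] by (simp add: sums_def)
      from LIMSEQ_D[OF this, of "e/4"] e obtain N0 where
        N0: "\<And>N. N \<ge> N0 \<Longrightarrow> norm ((\<Sum>i<N. set_fun (X n) (A i)) - set_fun (X n) (\<Union>i. A i)) < e/4"
        by auto
      have "norm ((\<Sum>i<N. L (A i)) - L (\<Union>i. A i)) < e" if N: "N \<ge> N0" for N
      proof -
        define U V where "U = (\<Union>i<N. A i)" and "V = (\<Union>i. A i)"
        have "norm (L U - set_fun (X n) U) \<le> e/4" "norm (L V - set_fun (X n) V) \<le> e/4"
          using diff[OF n, of U] diff[OF n, of V] A e by (auto simp: U_def V_def)
        moreover have "norm (set_fun (X n) U - set_fun (X n) V) < e/4"
          using N0[OF N] by (simp add: U_def V_def fin)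
        moreover have "norm (L U - L V) \<le> norm ((L U - set_fun (X n) U)
            + (set_fun (X n) U - set_fun (X n) V)) + norm (L V - set_fun (X n) V)"
          using norm_triangle_ineq4[of "(L U - set_fun (X n) U) + (set_fun (X n) U - set_fun (X n) V)"
              "L V - set_fun (X n) V"] by simp
        ultimately have "norm (L U - L V) < e"
          using e norm_triangle_ineq[of "L U - set_fun (X n) U" "set_fun (X n) U - set_fun (X n) V"]
          by linarith
        then show ?thesis by (simp add: U_def V_def finL)
      qed
      then show "\<exists>N0. \<forall>N\<ge>N0. norm ((\<Sum>i<N. L (A i)) - L (\<Union>i. A i)) < e" by blast
    qed
  qed
  have bvmD: "borel_vector_measure (\<lambda>E. L E - set_fun (X n) E)" for n
    using borel_vector_measure_add[OF bvm borel_vector_measure_scaleR[OF borel_vector_measure_set_fun, of "-1" "X n"]]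
    by simp
  have split: "variation L E \<le> variation (\<lambda>E. L E - set_fun (X n) E) E + variation (set_fun (X n)) E"
    for n E
    using variation_add_le[OF bvmD borel_vector_measure_set_fun, of n "X n" E] by simp
  have "L \<in> complex_radon_measures"
  proof (rule complex_radon_measuresI[OF bvm])
    show "L E = 0" if "E \<notin> sets borel" for E
      using L[of E] by (simp add: out that LIMSEQ_const_iff)
    obtain n where n: "variation (\<lambda>E. L E - set_fun (X n) E) UNIV \<le> ennreal 1"
      using var_le[of 1] by auto
    have "variation L UNIV \<le> ennreal 1 + ennreal (norm (X n))"
      using split[of UNIV n] n unfolding ennreal_norm_complex_radon_measure
      by (meson add_right_mono order_trans)
    then show "variation L UNIV < \<infinity>"
      by (auto intro: le_less_trans simp flip: ennreal_plus ennreal_1)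
    fix E :: "'a set" and e :: real assume E: "E \<in> sets borel" and e: "0 < e"
    obtain n where n: "variation (\<lambda>E. L E - set_fun (X n) E) UNIV \<le> ennreal (e/2)"
      using var_le[of "e/2"] e by auto
    obtain K where K: "compact K" "K \<subseteq> E" "variation (set_fun (X n)) (E - K) < ennreal (e/2)"
      using complex_radon_measuresD(4)[OF set_fun E half_gt_zero[OF e], of "X n"] by blast
    have "variation L (E - K) \<le> variation (\<lambda>E. L E - set_fun (X n) E) (E - K)
        + variation (set_fun (X n)) (E - K)" by (rule split)
    also have "\<dots> \<le> ennreal (e/2) + variation (set_fun (X n)) (E - K)"
    proof (intro add_right_mono order_trans[OF _ n] variation_mono bvmD)
      show "E - K \<in> sets borel" using E K(1) by (auto simp: compact_imp_closed)
    qed auto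
    also have "\<dots> < ennreal (e/2) + ennreal (e/2)"
      using K(3) by (simp add: ennreal_add_left_cancel_less)
    also have "\<dots> = ennreal e" using e by (simp flip: ennreal_plus)
    finally show "\<exists>K. compact K \<and> K \<subseteq> E \<and> variation L (E - K) < ennreal e" using K by blast
  qed
  then have rep: "set_fun (Complex_Radon_Measure L) = L" by (rule Complex_Radon_Measure_inverse)
  have "X \<longlonglongrightarrow> Complex_Radon_Measure L"
  proof (rule LIMSEQ_I)
    fix e :: real assume e: "0 < e"
    then obtain M where M: "\<And>n. n \<ge> M \<Longrightarrow> variation (\<lambda>E. L E - set_fun (X n) E) UNIV \<le> ennreal (e/2)"
      using var_le[of "e/2"] by auto
    have "norm (X n - Complex_Radon_Measure L) < e" if "n \<ge> M" for n
    proof -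
      have "set_fun (Complex_Radon_Measure L - X n) = (\<lambda>E. L E - set_fun (X n) E)"
        by (auto simp: rep)
      then have "ennreal (norm (Complex_Radon_Measure L - X n)) \<le> ennreal (e/2)"
        using M[OF that] by (simp add: ennreal_norm_complex_radon_measure)
      then have "norm (Complex_Radon_Measure L - X n) \<le> e/2" using e by simp
      then show ?thesis using e by (simp add: norm_minus_commute)
    qed
    then show "\<exists>M. \<forall>n\<ge>M. norm (X n - Complex_Radon_Measure L) < e" by blast
  qed
  then show "convergent X" by (auto simp: convergent_def)
qed


section \<open>Integration with respect to a complex measure\<close>

text \<open>
  Jordan decomposition \<open>\<nu>\<^sup>+ = (\<bar>\<nu>\<bar> + \<nu>)/2\<close> and \<open>\<nu>\<^sup>- = (\<bar>\<nu>\<bar> - \<nu>)/2\<close> of a real measure; the negative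
  part is \<open>jordan_pos (-\<nu>)\<close>.
\<close>

definition jordan_pos :: "('a::topological_space set \<Rightarrow> real) \<Rightarrow> 'a measure" where
  "jordan_pos \<nu> =
     measure_of UNIV (sets borel) (\<lambda>E. ennreal ((measure (total_variation \<nu>) E + \<nu> E) / 2))"

definition cmeasure_integral :: "('a::topological_space set \<Rightarrow> complex) \<Rightarrow> ('a \<Rightarrow> complex) \<Rightarrow> complex" where
  "cmeasure_integral \<nu> f =
     ((\<integral>x. f x \<partial>jordan_pos (\<lambda>E. Re (\<nu> E))) - (\<integral>x. f x \<partial>jordan_pos (\<lambda>E. - Re (\<nu> E)))) +
     \<i> * ((\<integral>x. f x \<partial>jordan_pos (\<lambda>E. Im (\<nu> E))) - (\<integral>x. f x \<partial>jordan_pos (\<lambda>E. - Im (\<nu> E))))"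

lemma sets_jordan_pos [simp, measurable_cong]: "sets (jordan_pos \<nu>) = sets borel"
  by (metis sets.sigma_sets_eq sets_measure_of space_borel subset_UNIV Pow_UNIV jordan_pos_def)

lemma space_jordan_pos [simp]: "space (jordan_pos \<nu>) = UNIV"
  by (simp add: jordan_pos_def space_measure_of_conv)

lemma finite_measure_total_variation:
  assumes "borel_vector_measure \<nu>" "variation \<nu> UNIV < \<infinity>"
  shows "finite_measure (total_variation \<nu>)"
  using assms by (intro finite_measureI) (simp add: emeasure_total_variation)

lemma emeasure_jordan_pos:
  fixes \<nu> :: "'a::topological_space set \<Rightarrow> real"
  assumes \<nu>: "borel_vector_measure \<nu>" "variation \<nu> UNIV < \<infinity>" and E: "E \<in> sets borel"
  shows "emeasure (jordan_pos \<nu>) E = ennreal ((measure (total_variation \<nu>) E + \<nu> E) / 2)"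
    and "\<bar>\<nu> E\<bar> \<le> measure (total_variation \<nu>) E"
proof -
  interpret finite_measure "total_variation \<nu>" by (rule finite_measure_total_variation[OF \<nu>])
  have nn: "\<bar>\<nu> E\<bar> \<le> measure (total_variation \<nu>) E" if "E \<in> sets borel" for E
    using norm_le_total_variation[OF \<nu>(1) that] by (simp add: emeasure_eq_measure)
  then show "\<bar>\<nu> E\<bar> \<le> measure (total_variation \<nu>) E" using E .
  have "sigma_algebra UNIV (sets (borel::'a measure))"
    by (metis sets.sigma_algebra_axioms space_borel)
  moreover have "positive (sets borel) (\<lambda>E. ennreal ((measure (total_variation \<nu>) E + \<nu> E) / 2))"
    by (simp add: positive_def borel_vector_measure_empty[OF \<nu>(1)])
  moreover have "countably_additive (sets borel) (\<lambda>E. ennreal ((measure (total_variation \<nu>) E + \<nu> E) / 2))"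
    unfolding countably_additive_def
  proof (intro allI impI)
    fix A :: "nat \<Rightarrow> 'a set"
    assume A: "range A \<subseteq> sets borel" "disjoint_family A"
    have "(\<lambda>i. measure (total_variation \<nu>) (A i)) sums measure (total_variation \<nu>) (\<Union>i. A i)"
      using A by (intro finite_measure_UNION) auto
    moreover have "(\<lambda>i. \<nu> (A i)) sums \<nu> (\<Union>i. A i)"
      by (rule borel_vector_measure_sums[OF \<nu>(1) A])
    ultimately have s: "(\<lambda>i. (measure (total_variation \<nu>) (A i) + \<nu> (A i)) / 2) sums
        ((measure (total_variation \<nu>) (\<Union>i. A i) + \<nu> (\<Union>i. A i)) / 2)"
      by (intro sums_divide sums_add)
    have "0 \<le> (measure (total_variation \<nu>) (A i) + \<nu> (A i)) / 2" for i
    proof -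
      have "A i \<in> sets borel" using A(1) by blast
      from nn[OF this] show ?thesis by simp
    qed
    from suminf_ennreal_eq[OF this s]
    show "(\<Sum>i. ennreal ((measure (total_variation \<nu>) (A i) + \<nu> (A i)) / 2)) =
        ennreal ((measure (total_variation \<nu>) (\<Union>i. A i) + \<nu> (\<Union>i. A i)) / 2)" .
  qed
  ultimately show "emeasure (jordan_pos \<nu>) E = ennreal ((measure (total_variation \<nu>) E + \<nu> E) / 2)"
    unfolding jordan_pos_def using E by (intro emeasure_measure_of_sigma)
qed

lemma variation_uminus: "variation (\<lambda>E. - \<nu> E) E = variation \<nu> E"
  by (simp add: variation_def)

lemma total_variation_uminus: "total_variation (\<lambda>E. - \<nu> E) = total_variation \<nu>"
  unfolding total_variation_def variation_uminus ..

lemma borel_vector_measure_uminus: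
  "borel_vector_measure \<nu> \<Longrightarrow> borel_vector_measure (\<lambda>E. - \<nu> E)"
  unfolding borel_vector_measure_def by (auto intro: sums_minus)

lemma measure_jordan_pos_diff:
  assumes \<nu>: "borel_vector_measure \<nu>" "variation \<nu> UNIV < \<infinity>" and E: "E \<in> sets borel"
  shows "measure (jordan_pos \<nu>) E - measure (jordan_pos (\<lambda>E. - \<nu> E)) E = \<nu> E"
proof -
  note 1 = emeasure_jordan_pos[OF \<nu> E]
  have 2: "emeasure (jordan_pos (\<lambda>E. - \<nu> E)) E = ennreal ((measure (total_variation \<nu>) E - \<nu> E) / 2)"
    using emeasure_jordan_pos(1)[OF borel_vector_measure_uminus[OF \<nu>(1)] _ E] \<nu>(2)
    by (simp add: variation_uminus total_variation_uminus)
  have "measure (jordan_pos \<nu>) E = (measure (total_variation \<nu>) E + \<nu> E) / 2"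
    using 1 unfolding measure_def[of "jordan_pos \<nu>"] by simp
  moreover have "measure (jordan_pos (\<lambda>E. - \<nu> E)) E = (measure (total_variation \<nu>) E - \<nu> E) / 2"
    using 1(2) 2 unfolding measure_def[of "jordan_pos (\<lambda>E. - \<nu> E)"] by simp
  ultimately show ?thesis by (simp add: field_simps)
qed

lemma emeasure_jordan_pos_le:
  assumes \<nu>: "borel_vector_measure \<nu>" "variation \<nu> UNIV < \<infinity>" and E: "E \<in> sets borel"
  shows "emeasure (jordan_pos \<nu>) E \<le> variation \<nu> E"
proof -
  interpret finite_measure "total_variation \<nu>" by (rule finite_measure_total_variation[OF \<nu>])
  have "emeasure (jordan_pos \<nu>) E \<le> ennreal (measure (total_variation \<nu>) E)"
    using emeasure_jordan_pos[OF \<nu> E] by (auto intro!: ennreal_leI)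
  then show ?thesis by (simp add: emeasure_total_variation[OF \<nu>(1) E] flip: emeasure_eq_measure)
qed

lemma variation_bounded_linear_le:
  fixes \<nu> :: "'a::topological_space set \<Rightarrow> 'b::real_normed_vector" and L :: "'b \<Rightarrow> 'c::real_normed_vector"
  assumes "\<And>x. norm (L x) \<le> norm x"
  shows "variation (\<lambda>E. L (\<nu> E)) E \<le> variation \<nu> E"
proof (rule variation_least)
  fix A :: "nat \<Rightarrow> 'a set"
  assume A: "range A \<subseteq> sets borel" "disjoint_family A" "(\<Union>n. A n) = E"
  have "(\<Sum>n. ennreal (norm (L (\<nu> (A n))))) \<le> (\<Sum>n. ennreal (norm (\<nu> (A n))))"
    using assms by (intro suminf_le) (auto intro: ennreal_leI)
  also have "\<dots> \<le> variation \<nu> E" by (rule variation_upper[OF A])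
  finally show "(\<Sum>n. ennreal (norm (L (\<nu> (A n))))) \<le> variation \<nu> E" .
qed

definition jordan_parts :: "('a::topological_space set \<Rightarrow> complex) \<Rightarrow> 'a measure set" where
  "jordan_parts \<nu> = {jordan_pos (\<lambda>E. Re (\<nu> E)), jordan_pos (\<lambda>E. - Re (\<nu> E)),
     jordan_pos (\<lambda>E. Im (\<nu> E)), jordan_pos (\<lambda>E. - Im (\<nu> E))}"

lemma jordan_parts_bounded:
  assumes \<nu>: "borel_vector_measure \<nu>" "variation \<nu> UNIV < \<infinity>"
    and M: "M \<in> jordan_parts \<nu>" and E: "E \<in> sets borel"
  shows "emeasure M E \<le> variation \<nu> E"
proof -
  have *: "emeasure (jordan_pos (\<lambda>E. L (\<nu> E))) E \<le> variation \<nu> E"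
    if L: "bounded_linear L" "\<And>x. norm (L x) \<le> norm x" for L :: "complex \<Rightarrow> real"
  proof -
    have "emeasure (jordan_pos (\<lambda>E. L (\<nu> E))) E \<le> variation (\<lambda>E. L (\<nu> E)) E"
      by (rule emeasure_jordan_pos_le[OF borel_vector_measure_bounded_linear[OF \<nu>(1) L(1)]
            le_less_trans[OF variation_bounded_linear_le[OF L(2)] \<nu>(2)] E])
    also have "\<dots> \<le> variation \<nu> E" by (rule variation_bounded_linear_le[OF L(2)])
    finally show ?thesis .
  qed
  show ?thesis
    using M *[OF bounded_linear_Re] *[OF bounded_linear_Im]
      *[OF bounded_linear_minus[OF bounded_linear_Re]] *[OF bounded_linear_minus[OF bounded_linear_Im]]
    unfolding jordan_parts_def
    by (elim insertE emptyE) (simp_all add: abs_Re_le_cmod abs_Im_le_cmod)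
qed

lemma jordan_parts_sets: "M \<in> jordan_parts \<nu> \<Longrightarrow> sets M = sets borel"
  by (auto simp: jordan_parts_def)

lemma finite_measure_jordan_parts:
  assumes \<nu>: "borel_vector_measure \<nu>" "variation \<nu> UNIV < \<infinity>" and M: "M \<in> jordan_parts \<nu>"
  shows "finite_measure M"
proof (rule finite_measureI)
  have "space M = UNIV" using sets_eq_imp_space_eq[OF jordan_parts_sets[OF M]] by simp
  then show "emeasure M (space M) \<noteq> \<infinity>"
    using le_less_trans[OF jordan_parts_bounded[OF \<nu> M, of UNIV] \<nu>(2)] by simp
qed

lemma integrable_jordan_parts:
  fixes f :: "'a::topological_space \<Rightarrow> complex"
  assumes "borel_vector_measure \<nu>" "variation \<nu> UNIV < \<infinity>" "M \<in> jordan_parts \<nu>"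
    and f: "f \<in> borel_measurable borel" "\<And>x. norm (f x) \<le> C"
  shows "integrable M f"
proof -
  interpret finite_measure M by (rule finite_measure_jordan_parts[OF assms(1-3)])
  have "f \<in> borel_measurable M"
    using f(1) measurable_cong_sets[OF jordan_parts_sets[OF assms(3)] refl] by blast
  then show ?thesis using f(2) by (intro integrable_const_bound[of _ C]) auto
qed

lemma cmeasure_integral_indicator:
  assumes \<nu>: "borel_vector_measure \<nu>" "variation \<nu> UNIV < \<infinity>" and E: "E \<in> sets borel"
  shows "cmeasure_integral \<nu> (indicator E) = \<nu> E"
proof -
  have int: "(\<integral>x. indicator E x \<partial>M) = complex_of_real (measure M E)" if "M \<in> jordan_parts \<nu>" for M
  proof -
    interpret finite_measure M by (rule finite_measure_jordan_parts[OF \<nu> that])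
    have "E \<in> sets M" using E jordan_parts_sets[OF that] by simp
    then have "(\<integral>x. indicator E x *\<^sub>R (1::complex) \<partial>M) = measure M E *\<^sub>R 1"
      by (intro has_bochner_integral_integral_eq has_bochner_integral_indicator) (simp_all add: less_top[symmetric])
    moreover have "(\<lambda>x. indicator E x *\<^sub>R (1::complex)) = indicator E"
      by (auto simp: indicator_def)
    ultimately show ?thesis by (metis scaleR_conv_of_real mult.right_neutral)
  qed
  have d: "measure (jordan_pos (\<lambda>E. L (\<nu> E))) E - measure (jordan_pos (\<lambda>E. - L (\<nu> E))) E = L (\<nu> E)"
    if L: "bounded_linear L" "\<And>x. norm (L x) \<le> norm x" for L :: "complex \<Rightarrow> real"
    by (rule measure_jordan_pos_diff[OF borel_vector_measure_bounded_linear[OF \<nu>(1) L(1)]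
            le_less_trans[OF variation_bounded_linear_le[OF L(2)] \<nu>(2)] E])
  have "cmeasure_integral \<nu> (indicator E) = complex_of_real (Re (\<nu> E)) + \<i> * complex_of_real (Im (\<nu> E))"
    unfolding cmeasure_integral_def
    using d[of Re] d[of Im]
    by (simp add: int jordan_parts_def bounded_linear_Re bounded_linear_Im abs_Re_le_cmod abs_Im_le_cmod
        flip: of_real_diff)
  then show ?thesis by (simp add: complex_eq flip: complex_eq)
qed

text \<open>
  A continuity property that determines a functional on bounded Borel functions by its values on
  indicator functions.
\<close>

definition bounded_borel_functional :: "(('a::topological_space \<Rightarrow> complex) \<Rightarrow> complex) \<Rightarrow> bool" where
  "bounded_borel_functional \<Phi> \<longleftrightarrow>
     (\<forall>f g C. f \<in> borel_measurable borel \<longrightarrow> g \<in> borel_measurable borel \<longrightarrow>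
        (\<forall>x. norm (f x) \<le> C) \<longrightarrow> (\<forall>x. norm (g x) \<le> C) \<longrightarrow> \<Phi> (\<lambda>x. f x + g x) = \<Phi> f + \<Phi> g) \<and>
     (\<forall>f c C. f \<in> borel_measurable borel \<longrightarrow> (\<forall>x. norm (f x) \<le> C) \<longrightarrow> \<Phi> (\<lambda>x. c * f x) = c * \<Phi> f) \<and>
     (\<forall>F f C. (\<forall>n::nat. F n \<in> borel_measurable borel) \<longrightarrow> (\<forall>n x. norm (F n x) \<le> C) \<longrightarrow>
        (\<forall>x. (\<lambda>n. F n x) \<longlonglongrightarrow> f x) \<longrightarrow> (\<lambda>n. \<Phi> (F n)) \<longlonglongrightarrow> \<Phi> f)"

lemma bounded_borel_functional_add:
  assumes "bounded_borel_functional \<Phi>" "f \<in> borel_measurable borel" "g \<in> borel_measurable borel"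
    "\<And>x. norm (f x) \<le> C" "\<And>x. norm (g x) \<le> D"
  shows "\<Phi> (\<lambda>x. f x + g x) = \<Phi> f + \<Phi> g"
proof -
  have "\<And>x. norm (f x) \<le> max C D" "\<And>x. norm (g x) \<le> max C D"
    using assms(4,5) by (simp_all add: le_max_iff_disj)
  then show ?thesis using assms(1-3) unfolding bounded_borel_functional_def by blast
qed

lemma bounded_borel_functional_mult:
  assumes "bounded_borel_functional \<Phi>" "f \<in> borel_measurable borel" "\<And>x. norm (f x) \<le> C"
  shows "\<Phi> (\<lambda>x. c * f x) = c * \<Phi> f"
  using assms unfolding bounded_borel_functional_def by blast

lemma bounded_borel_functional_lim:
  assumes "bounded_borel_functional \<Phi>" "\<And>n. F n \<in> borel_measurable borel"
    "\<And>n x. norm (F n x) \<le> C" "\<And>x. (\<lambda>n. F n x) \<longlonglongrightarrow> f x"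
  shows "(\<lambda>n. \<Phi> (F n)) \<longlonglongrightarrow> \<Phi> f"
  using assms unfolding bounded_borel_functional_def by blast

lemma bounded_borel_functional_sum:
  fixes f :: "'i \<Rightarrow> 'a::topological_space \<Rightarrow> complex"
  assumes \<Phi>: "bounded_borel_functional \<Phi>" and "finite S"
    and f: "\<And>i. i \<in> S \<Longrightarrow> f i \<in> borel_measurable borel" "\<And>i x. i \<in> S \<Longrightarrow> norm (f i x) \<le> C i"
  shows "\<Phi> (\<lambda>x. \<Sum>i\<in>S. f i x) = (\<Sum>i\<in>S. \<Phi> (f i))"
  using \<open>finite S\<close> f
proof (induction S rule: finite_induct)
  case empty
  show ?case using bounded_borel_functional_mult[OF \<Phi>, of "\<lambda>_. 0" 0 0] by simp
next
  case (insert i S)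
  have "\<Phi> (\<lambda>x. f i x + (\<Sum>j\<in>S. f j x)) = \<Phi> (f i) + \<Phi> (\<lambda>x. \<Sum>j\<in>S. f j x)"
  proof (rule bounded_borel_functional_add[OF \<Phi>])
    show "f i \<in> borel_measurable borel" "\<And>x. norm (f i x) \<le> C i"
      using insert.prems by simp_all
    show "(\<lambda>x. \<Sum>j\<in>S. f j x) \<in> borel_measurable borel"
      using insert.prems(1) by (intro borel_measurable_sum) simp
    show "norm (\<Sum>j\<in>S. f j x) \<le> sum C S" for x
      using insert.prems(2) by (intro sum_norm_le) simp
  qed
  also have "\<Phi> (\<lambda>x. \<Sum>j\<in>S. f j x) = (\<Sum>j\<in>S. \<Phi> (f j))"
    using insert.prems by (intro insert.IH) simp_all
  finally show ?case using insert.hyps by simp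
qed

lemma bounded_borel_functional_eqI:
  fixes f :: "'a::topological_space \<Rightarrow> complex"
  assumes \<Phi>: "bounded_borel_functional \<Phi>" and \<Psi>: "bounded_borel_functional \<Psi>"
    and eq: "\<And>E. E \<in> sets borel \<Longrightarrow> \<Phi> (indicator E) = \<Psi> (indicator E)"
    and f: "f \<in> borel_measurable borel" "\<And>x. norm (f x) \<le> C"
  shows "\<Phi> f = \<Psi> f"
proof -
  obtain F :: "nat \<Rightarrow> 'a \<Rightarrow> complex" where F: "\<And>i. simple_function borel (F i)"
      "\<And>x. (\<lambda>i. F i x) \<longlonglongrightarrow> f x" "\<And>i x. norm (F i x) \<le> 2 * norm (f x)"
    using borel_measurable_implies_sequence_metric[OF f(1), of 0] by auto
  have le: "norm (F i x) \<le> 2 * C" for i x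
    using F(3)[of i x] f(2)[of x] by linarith
  have *: "\<Xi> (F i) = (\<Sum>y\<in>range (F i). y * \<Xi> (indicator (F i -` {y})))"
    if \<Xi>: "bounded_borel_functional \<Xi>" for \<Xi> :: "('a \<Rightarrow> complex) \<Rightarrow> complex" and i
  proof -
    have fin: "finite (range (F i))" and ms: "\<And>y. F i -` {y} \<in> sets borel"
      using simple_functionD[OF F(1)[of i]] by simp_all
    have "F i x = (\<Sum>y\<in>range (F i). y * indicator (F i -` {y}) x)" for x
    proof -
      have "(\<Sum>y\<in>range (F i). y * indicator (F i -` {y}) x) = (\<Sum>y\<in>{F i x}. y * indicator (F i -` {y}) x)"
        using fin by (intro sum.mono_neutral_right) auto
      then show ?thesis by simp
    qed
    then have "F i = (\<lambda>x. \<Sum>y\<in>range (F i). y * indicator (F i -` {y}) x)" by (rule ext)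
    then have "\<Xi> (F i) = \<Xi> (\<lambda>x. \<Sum>y\<in>range (F i). y * indicator (F i -` {y}) x)" by (rule arg_cong)
    also have "\<dots> = (\<Sum>y\<in>range (F i). \<Xi> (\<lambda>x. y * indicator (F i -` {y}) x))"
    proof (rule bounded_borel_functional_sum[OF \<Xi> fin, where C = norm])
      show "(\<lambda>x. y * indicator (F i -` {y}) x) \<in> borel_measurable borel" for y :: complex
        using ms by (intro borel_measurable_times borel_measurable_indicator) auto
    qed (simp add: norm_mult indicator_def)
    also have "\<dots> = (\<Sum>y\<in>range (F i). y * \<Xi> (indicator (F i -` {y})))"
    proof (intro sum.cong refl bounded_borel_functional_mult[OF \<Xi>])
      show "indicator (F i -` {y}) \<in> borel_measurable borel" for y
        by (rule borel_measurable_indicator[OF ms])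
      show "norm (indicator (F i -` {y}) x :: complex) \<le> 1" for x y
        by (simp add: indicator_def)
    qed
    finally show ?thesis .
  qed
  have ms: "\<And>i y. F i -` {y} \<in> sets borel"
    using simple_functionD(2)[OF F(1)] by simp
  have "\<Phi> (F i) = \<Psi> (F i)" for i
    unfolding *[OF \<Phi>] *[OF \<Psi>] by (simp add: eq ms)
  moreover have "F i \<in> borel_measurable borel" for i
    by (rule borel_measurable_simple_function[OF F(1)])
  ultimately have "(\<lambda>i. \<Psi> (F i)) \<longlonglongrightarrow> \<Phi> f" "(\<lambda>i. \<Psi> (F i)) \<longlonglongrightarrow> \<Psi> f"
    using bounded_borel_functional_lim[where F = F and f = f, OF \<Phi> _ le F(2)]
      bounded_borel_functional_lim[where F = F and f = f, OF \<Psi> _ le F(2)]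
    by simp_all
  then show ?thesis by (rule LIMSEQ_unique)
qed

lemma bounded_borel_functional_cmeasure_integral:
  fixes \<nu> :: "'a::topological_space set \<Rightarrow> complex"
  assumes \<nu>: "borel_vector_measure \<nu>" "variation \<nu> UNIV < \<infinity>"
  shows "bounded_borel_functional (cmeasure_integral \<nu>)"
proof -
  have parts: "jordan_pos (\<lambda>E. Re (\<nu> E)) \<in> jordan_parts \<nu>" "jordan_pos (\<lambda>E. - Re (\<nu> E)) \<in> jordan_parts \<nu>"
    "jordan_pos (\<lambda>E. Im (\<nu> E)) \<in> jordan_parts \<nu>" "jordan_pos (\<lambda>E. - Im (\<nu> E)) \<in> jordan_parts \<nu>"
    by (simp_all add: jordan_parts_def)
  have add: "(\<integral>x. f x + g x \<partial>M) = (\<integral>x. f x \<partial>M) + (\<integral>x. g x \<partial>M)"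
    if "f \<in> borel_measurable borel" "g \<in> borel_measurable borel"
      "\<forall>x. norm (f x) \<le> C" "\<forall>x. norm (g x) \<le> C" "M \<in> jordan_parts \<nu>"
    for f g :: "'a \<Rightarrow> complex" and C M
    using that by (intro Bochner_Integration.integral_add integrable_jordan_parts[OF \<nu>]) auto
  have lim: "(\<lambda>n. \<integral>x. F n x \<partial>M) \<longlonglongrightarrow> (\<integral>x. f x \<partial>M)"
    if F: "\<forall>n. F n \<in> borel_measurable borel" "\<forall>n x. norm (F n x) \<le> C" "\<forall>x. (\<lambda>n. F n x) \<longlonglongrightarrow> f x"
      and M: "M \<in> jordan_parts \<nu>"
    for F :: "nat \<Rightarrow> 'a \<Rightarrow> complex" and f C M
  proof (rule integral_dominated_convergence[where w = "\<lambda>_. C"])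
    interpret finite_measure M by (rule finite_measure_jordan_parts[OF \<nu> M])
    have ms: "borel_measurable M = (borel_measurable borel :: ('a \<Rightarrow> complex) set)"
      by (rule measurable_cong_sets[OF jordan_parts_sets[OF M] refl])
    show "f \<in> borel_measurable M"
      unfolding ms by (rule borel_measurable_LIMSEQ_metric[of F]) (simp_all add: F)
    show "F n \<in> borel_measurable M" for n unfolding ms by (simp add: F)
    show "integrable M (\<lambda>_. C)" by simp
    show "AE x in M. (\<lambda>n. F n x) \<longlonglongrightarrow> f x" "\<And>n. AE x in M. norm (F n x) \<le> C"
      using F by simp_all
  qed
  show ?thesis
    unfolding bounded_borel_functional_def
  proof (intro conjI allI impI)
    fix f g :: "'a \<Rightarrow> complex" and C
    assume fg: "f \<in> borel_measurable borel" "g \<in> borel_measurable borel"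
      "\<forall>x. norm (f x) \<le> C" "\<forall>x. norm (g x) \<le> C"
    show "cmeasure_integral \<nu> (\<lambda>x. f x + g x) = cmeasure_integral \<nu> f + cmeasure_integral \<nu> g"
      unfolding cmeasure_integral_def add[OF fg parts(1)] add[OF fg parts(2)] add[OF fg parts(3)]
        add[OF fg parts(4)] by (simp add: algebra_simps)
  next
    fix f :: "'a \<Rightarrow> complex" and c :: complex and C :: real
    show "cmeasure_integral \<nu> (\<lambda>x. c * f x) = c * cmeasure_integral \<nu> f"
      unfolding cmeasure_integral_def integral_mult_right_zero by (simp only: algebra_simps)
  next
    fix F :: "nat \<Rightarrow> 'a \<Rightarrow> complex" and f C
    assume "\<forall>n. F n \<in> borel_measurable borel" "\<forall>n x. norm (F n x) \<le> C" "\<forall>x. (\<lambda>n. F n x) \<longlonglongrightarrow> f x"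
    note l = lim[OF this]
    show "(\<lambda>n. cmeasure_integral \<nu> (F n)) \<longlonglongrightarrow> cmeasure_integral \<nu> f"
      unfolding cmeasure_integral_def
      by (intro tendsto_add tendsto_diff tendsto_mult_left l parts)
  qed
qed

lemma bounded_borel_functional_reindex:
  assumes \<Phi>: "bounded_borel_functional \<Phi>"
    and g: "g \<in> borel_measurable borel" "\<And>x. norm (g x) \<le> D" and h: "h \<in> measurable borel borel"
  shows "bounded_borel_functional (\<lambda>f. \<Phi> (\<lambda>x. g x * f (h x)))"
  unfolding bounded_borel_functional_def
proof (intro conjI allI impI)
  have D: "0 \<le> D" using g(2) norm_ge_zero order_trans by blast
  have bd: "norm (g x * f (h x)) \<le> D * C" if "\<And>x. norm (f x) \<le> C" for f C x
    unfolding norm_mult using g(2) that D by (intro mult_mono) auto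
  have ms: "(\<lambda>x. g x * f (h x)) \<in> borel_measurable borel" if "f \<in> borel_measurable borel" for f
    using measurable_compose[OF h that] g(1) by (intro borel_measurable_times)
  {
    fix f f' :: "'b \<Rightarrow> complex" and C
    assume f: "f \<in> borel_measurable borel" "f' \<in> borel_measurable borel"
      "\<forall>x. norm (f x) \<le> C" "\<forall>x. norm (f' x) \<le> C"
    have "\<Phi> (\<lambda>x. g x * f (h x) + g x * f' (h x)) = \<Phi> (\<lambda>x. g x * f (h x)) + \<Phi> (\<lambda>x. g x * f' (h x))"
      using f by (intro bounded_borel_functional_add[OF \<Phi> ms ms bd bd]) auto
    then show "\<Phi> (\<lambda>x. g x * (f (h x) + f' (h x))) = \<Phi> (\<lambda>x. g x * f (h x)) + \<Phi> (\<lambda>x. g x * f' (h x))"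
      by (simp add: distrib_left)
  next
    fix f :: "'b \<Rightarrow> complex" and c C
    assume f: "f \<in> borel_measurable borel" "\<forall>x. norm (f x) \<le> C"
    have "\<Phi> (\<lambda>x. c * (g x * f (h x))) = c * \<Phi> (\<lambda>x. g x * f (h x))"
      using f by (intro bounded_borel_functional_mult[OF \<Phi> ms bd]) auto
    then show "\<Phi> (\<lambda>x. g x * (c * f (h x))) = c * \<Phi> (\<lambda>x. g x * f (h x))"
      by (simp add: mult.left_commute)
  next
    fix F :: "nat \<Rightarrow> 'b \<Rightarrow> complex" and f C
    assume F: "\<forall>n. F n \<in> borel_measurable borel" "\<forall>n x. norm (F n x) \<le> C" "\<forall>x. (\<lambda>n. F n x) \<longlonglongrightarrow> f x"
    show "(\<lambda>n. \<Phi> (\<lambda>x. g x * F n (h x))) \<longlonglongrightarrow> \<Phi> (\<lambda>x. g x * f (h x))"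
      using F by (intro bounded_borel_functional_lim[OF \<Phi> ms bd] tendsto_mult tendsto_const) auto
  }
qed

lemma borel_vector_measure_integral:
  assumes \<Phi>: "bounded_borel_functional \<Phi>" and g: "g \<in> borel_measurable borel" "\<And>x. norm (g x) \<le> D"
  shows "borel_vector_measure (\<lambda>E. if E \<in> sets borel then \<Phi> (\<lambda>x. indicator E x *\<^sub>R g x) else 0)"
  unfolding borel_vector_measure_def
proof (intro allI impI)
  fix A :: "nat \<Rightarrow> 'a set"
  assume A: "range A \<subseteq> sets borel" "disjoint_family A"
  have A': "A n \<in> sets borel" for n using A(1) by blast
  have D: "0 \<le> D" using g(2) norm_ge_zero order_trans by blast
  have bd: "norm (indicator E x *\<^sub>R g x) \<le> D" for E :: "'a set" and x
    using g(2)[of x] D by (auto simp: indicator_def)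
  have ms: "(\<lambda>x. indicator E x *\<^sub>R g x) \<in> borel_measurable borel" if "E \<in> sets borel" for E
    using g(1) that by (intro borel_measurable_scaleR borel_measurable_indicator)
  have sum: "(\<Sum>i<N. indicator (A i) x *\<^sub>R g x) = indicator (\<Union>i<N. A i) x *\<^sub>R g x" for N x
  proof -
    have "indicat_real (\<Union>i<N. A i) x = (\<Sum>i<N. indicator (A i) x)"
      using A(2) by (intro indicator_UN_disjoint) (auto simp: disjoint_family_on_def)
    then show ?thesis by (simp add: scaleR_sum_left)
  qed
  have "(\<Sum>i<N. \<Phi> (\<lambda>x. indicator (A i) x *\<^sub>R g x)) = \<Phi> (\<lambda>x. indicator (\<Union>i<N. A i) x *\<^sub>R g x)" for N
    unfolding sum[symmetric] using A' ms bd
    by (intro bounded_borel_functional_sum[OF \<Phi>, symmetric]) auto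
  moreover have "(\<lambda>N. \<Phi> (\<lambda>x. indicator (\<Union>i<N. A i) x *\<^sub>R g x)) \<longlonglongrightarrow> \<Phi> (\<lambda>x. indicator (\<Union>i. A i) x *\<^sub>R g x)"
  proof (rule bounded_borel_functional_lim[OF \<Phi> ms bd])
    show "(\<Union>i<N. A i) \<in> sets borel" for N using A' by auto
    show "(\<lambda>N. indicator (\<Union>i<N. A i) x *\<^sub>R g x) \<longlonglongrightarrow> indicator (\<Union>i. A i) x *\<^sub>R g x" for x
      by (intro tendsto_scaleR tendsto_const LIMSEQ_indicator_UN)
  qed
  ultimately have "(\<lambda>n. \<Phi> (\<lambda>x. indicator (A n) x *\<^sub>R g x)) sums \<Phi> (\<lambda>x. indicator (\<Union>n. A n) x *\<^sub>R g x)"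
    unfolding sums_def by simp
  moreover have "(\<Union>n. A n) \<in> sets borel" using A' by auto
  ultimately show "(\<lambda>n. if A n \<in> sets borel then \<Phi> (\<lambda>x. indicator (A n) x *\<^sub>R g x) else 0) sums
      (if (\<Union>n. A n) \<in> sets borel then \<Phi> (\<lambda>x. indicator (\<Union>n. A n) x *\<^sub>R g x) else 0)"
    using A' by simp
qed

lemma norm_cmeasure_integral_le:
  fixes g :: "'a::topological_space \<Rightarrow> complex"
  assumes \<nu>: "borel_vector_measure \<nu>" "variation \<nu> UNIV < \<infinity>"
    and g: "g \<in> borel_measurable borel" "\<And>x. norm (g x) \<le> D" and E: "E \<in> sets borel"
  shows "ennreal (norm (cmeasure_integral \<nu> (\<lambda>x. indicator E x *\<^sub>R g x))) \<le> ennreal (4 * D) * variation \<nu> E"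
proof -
  interpret T: finite_measure "total_variation \<nu>" by (rule finite_measure_total_variation[OF \<nu>])
  define v where "v = measure (total_variation \<nu>) E"
  have v: "variation \<nu> E = ennreal v"
    by (simp add: v_def emeasure_total_variation[OF \<nu>(1) E] flip: T.emeasure_eq_measure)
  have D: "0 \<le> D" using g(2) norm_ge_zero order_trans by blast
  have le: "norm (\<integral>x. indicator E x *\<^sub>R g x \<partial>M) \<le> D * v" if M: "M \<in> jordan_parts \<nu>" for M
  proof -
    interpret finite_measure M by (rule finite_measure_jordan_parts[OF \<nu> M])
    have EM: "E \<in> sets M" using E jordan_parts_sets[OF M] by simp
    have "norm (\<integral>x. indicator E x *\<^sub>R g x \<partial>M) \<le> (\<integral>x. indicator E x *\<^sub>R D \<partial>M)"
    proof (rule order_trans[OF integral_norm_bound integral_mono])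
      show "integrable M (\<lambda>x. norm (indicator E x *\<^sub>R g x))"
      proof (rule integrable_norm, rule integrable_jordan_parts[OF \<nu> M])
        show "(\<lambda>x. indicator E x *\<^sub>R g x) \<in> borel_measurable borel"
          using g(1) E by (intro borel_measurable_scaleR borel_measurable_indicator)
        show "norm (indicator E x *\<^sub>R g x) \<le> D" for x using g(2)[of x] D by (auto simp: indicator_def)
      qed
      show "integrable M (\<lambda>x. indicator E x *\<^sub>R D)"
        using EM by (intro integrable_scaleR_left integrable_real_indicator) (simp_all add: less_top[symmetric])
    qed (use g(2) in \<open>auto simp: indicator_def\<close>)
    also have "\<dots> = D * measure M E" using EM by simp
    also have "measure M E \<le> v"
      using jordan_parts_bounded[OF \<nu> M E] by (simp add: v emeasure_eq_measure v_def)
    finally show ?thesis using D by (simp add: mult_left_mono)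
  qed
  define I where "I M = (\<integral>x. indicator E x *\<^sub>R g x \<partial>M)" for M
  have tri: "norm ((a - b) + \<i> * (c - d)) \<le> norm a + norm b + (norm c + norm d)" for a b c d :: complex
    using norm_triangle_ineq[of "a - b" "\<i> * (c - d)"] norm_triangle_ineq4[of a b] norm_triangle_ineq4[of c d]
    by (simp add: norm_mult)
  have leI: "norm (I M) \<le> D * v" if "M \<in> jordan_parts \<nu>" for M
    unfolding I_def by (rule le[OF that])
  have "norm (cmeasure_integral \<nu> (\<lambda>x. indicator E x *\<^sub>R g x)) \<le> (D * v + D * v) + (D * v + D * v)"
    unfolding cmeasure_integral_def I_def[symmetric]
    by (intro order_trans[OF tri] add_mono leI) (simp_all add: jordan_parts_def)
  then have "ennreal (norm (cmeasure_integral \<nu> (\<lambda>x. indicator E x *\<^sub>R g x))) \<le> ennreal (4 * D * v)"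
    by (intro ennreal_leI) simp
  also have "\<dots> = ennreal (4 * D) * variation \<nu> E"
    using D by (simp add: v ennreal_mult' v_def)
  finally show ?thesis .
qed


section \<open>Weighted composition operators and their adjoints\<close>

definition weighted_composition :: "('a \<Rightarrow> 'a) \<Rightarrow> ('a \<Rightarrow> real) \<Rightarrow> ('a \<Rightarrow> complex) \<Rightarrow> 'a \<Rightarrow> complex" where
  "weighted_composition \<alpha> w f = (\<lambda>t. of_real (w t) * f (\<alpha> t))"

text \<open>
  The adjoint of \<^const>\<open>weighted_composition\<close>, as an operator on \<open>M(\<Omega>)\<close>:
  \<open>E \<mapsto> \<integral>\<^sub>E w \<circ> \<alpha>\<^sup>-\<^sup>1 d(\<mu> \<circ> \<alpha>\<^sup>-\<^sup>1)\<close>.  It is only meaningful if \<open>\<alpha>\<close> is a homeomorphism and \<open>w\<close> is bounded and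
  Borel measurable; under these conditions \<open>set_fun_weighted_composition_adjoint\<close> below shows that
  the right-hand side is a complex Radon measure, and \<open>weighted_composition_adjoint_duality\<close> that
  the duality relation holds for all bounded Borel functions, in particular on \<open>C\<^sub>0(\<Omega>)\<close>.
\<close>

definition weighted_composition_adjoint ::
  "('a::t2_space \<Rightarrow> 'a) \<Rightarrow> ('a \<Rightarrow> real) \<Rightarrow> 'a complex_radon_measure \<Rightarrow> 'a complex_radon_measure" where
  "weighted_composition_adjoint \<alpha> w \<mu> = Complex_Radon_Measure
     (\<lambda>E. if E \<in> sets borel
          then cmeasure_integral (\<lambda>F. set_fun \<mu> (\<alpha> -` F)) (\<lambda>t. indicator E t *\<^sub>R of_real (w (inv \<alpha> t)))
          else 0)"

lemma homeomorphic_map_euclideanD: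
  fixes \<alpha> :: "'a::topological_space \<Rightarrow> 'a"
  assumes "homeomorphic_map euclidean euclidean \<alpha>"
  shows "bij \<alpha>" "continuous_on UNIV \<alpha>" "continuous_on UNIV (inv \<alpha>)"
proof -
  show b: "bij \<alpha>" and "continuous_on UNIV \<alpha>"
    using assms by (auto simp: homeomorphic_eq_everything_map bij_def)
  have "inv \<alpha> -` B = \<alpha> ` B" for B using b
    by (metis bij_vimage_eq_inv_image bij_imp_bij_inv inv_inv_eq)
  moreover have "open (\<alpha> ` B)" if "open B" for B
    using assms that by (auto simp: homeomorphic_eq_everything_map open_map_def)
  ultimately show "continuous_on UNIV (inv \<alpha>)"
    unfolding continuous_on_open_vimage[OF open_UNIV] by simp
qed

lemma borel_vector_measure_push:
  fixes \<nu> :: "'a::topological_space set \<Rightarrow> 'b::real_normed_vector" and h :: "'a \<Rightarrow> 'c::topological_space"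
  assumes \<nu>: "borel_vector_measure \<nu>" and h: "h \<in> measurable borel borel"
  shows "borel_vector_measure (\<lambda>F. \<nu> (h -` F))"
  unfolding borel_vector_measure_def
proof (intro allI impI)
  fix A :: "nat \<Rightarrow> 'c set"
  assume A: "range A \<subseteq> sets borel" "disjoint_family A"
  have "(\<lambda>n. \<nu> (h -` A n)) sums \<nu> (\<Union>n. h -` A n)"
  proof (rule borel_vector_measure_sums[OF \<nu>])
    show "range (\<lambda>n. h -` A n) \<subseteq> sets borel"
      using A(1) measurable_sets[OF h] by auto
    show "disjoint_family (\<lambda>n. h -` A n)"
      using A(2) unfolding disjoint_family_on_def by (metis vimage_Int vimage_empty)
  qed
  then show "(\<lambda>n. \<nu> (h -` A n)) sums \<nu> (h -` (\<Union>n. A n))" by (simp add: vimage_UN)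
qed

lemma variation_push_le:
  fixes \<nu> :: "'a::topological_space set \<Rightarrow> 'b::real_normed_vector" and h :: "'a \<Rightarrow> 'c::topological_space"
  assumes h: "h \<in> measurable borel borel"
  shows "variation (\<lambda>F. \<nu> (h -` F)) E \<le> variation \<nu> (h -` E)"
proof (rule variation_least)
  fix A :: "nat \<Rightarrow> 'c set"
  assume A: "range A \<subseteq> sets borel" "disjoint_family A" "(\<Union>n. A n) = E"
  show "(\<Sum>n. ennreal (norm (\<nu> (h -` A n)))) \<le> variation \<nu> (h -` E)"
  proof (rule variation_upper)
    show "range (\<lambda>n. h -` A n) \<subseteq> sets borel"
      using A(1) measurable_sets[OF h] by auto
    show "disjoint_family (\<lambda>n. h -` A n)"
      using A(2) unfolding disjoint_family_on_def by (metis vimage_Int vimage_empty)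
    show "(\<Union>n. h -` A n) = h -` E" using A(3) by auto
  qed
qed

lemma variation_set_fun_finite: "variation (set_fun \<mu>) UNIV < \<infinity>"
  by (rule complex_radon_measuresD(3)[OF set_fun])

lemma cmeasure_integral_push:
  fixes \<mu> :: "'a::t2_space complex_radon_measure" and f :: "'b::topological_space \<Rightarrow> complex"
  assumes h: "h \<in> measurable borel borel"
    and f: "f \<in> borel_measurable borel" "\<And>x. norm (f x) \<le> C"
  shows "cmeasure_integral (\<lambda>F. set_fun \<mu> (h -` F)) f = cmeasure_integral (set_fun \<mu>) (\<lambda>x. f (h x))"
proof -
  note bvm = borel_vector_measure_push[OF borel_vector_measure_set_fun h, of \<mu>]
  have fin: "variation (\<lambda>F. set_fun \<mu> (h -` F)) UNIV < \<infinity>"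
    using le_less_trans[OF variation_push_le[OF h, of "set_fun \<mu>" UNIV]] variation_set_fun_finite[of \<mu>]
    by simp
  have one: "(\<lambda>x. 1) \<in> borel_measurable borel" "\<And>x::'a. norm (1::complex) \<le> 1" by simp_all
  have "cmeasure_integral (\<lambda>F. set_fun \<mu> (h -` F)) f = cmeasure_integral (set_fun \<mu>) (\<lambda>x. 1 * f (h x))"
  proof (rule bounded_borel_functional_eqI[OF bounded_borel_functional_cmeasure_integral[OF bvm fin] _ _ f])
    show "bounded_borel_functional (\<lambda>f. cmeasure_integral (set_fun \<mu>) (\<lambda>x. 1 * f (h x)))"
      by (rule bounded_borel_functional_reindex[OF bounded_borel_functional_cmeasure_integral[OF
              borel_vector_measure_set_fun variation_set_fun_finite] one h])
    fix E :: "'b set" assume E: "E \<in> sets borel"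
    then have hE: "h -` E \<in> sets borel" using measurable_sets[OF h E] by simp
    have "(\<lambda>x. 1 * indicator E (h x)) = (indicator (h -` E) :: 'a \<Rightarrow> complex)"
      by (auto simp: indicator_def)
    then show "cmeasure_integral (\<lambda>F. set_fun \<mu> (h -` F)) (indicator E) =
        cmeasure_integral (set_fun \<mu>) (\<lambda>x. 1 * indicator E (h x))"
      by (simp only: cmeasure_integral_indicator[OF bvm fin E]
          cmeasure_integral_indicator[OF borel_vector_measure_set_fun variation_set_fun_finite hE])
  qed
  then show ?thesis by simp
qed

lemma
  fixes \<alpha> :: "'a::t2_space \<Rightarrow> 'a" and w :: "'a \<Rightarrow> real"
  assumes \<alpha>: "homeomorphic_map euclidean euclidean \<alpha>"
    and w: "w \<in> borel_measurable borel" "\<And>x. \<bar>w x\<bar> \<le> C"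
  shows set_fun_weighted_composition_adjoint:
      "E \<in> sets borel \<Longrightarrow> set_fun (weighted_composition_adjoint \<alpha> w \<mu>) E =
        cmeasure_integral (\<lambda>F. set_fun \<mu> (\<alpha> -` F)) (\<lambda>t. indicator E t *\<^sub>R of_real (w (inv \<alpha> t)))"
    and variation_weighted_composition_adjoint:
      "E \<in> sets borel \<Longrightarrow> variation (set_fun (weighted_composition_adjoint \<alpha> w \<mu>)) E
        \<le> ennreal (4 * C) * variation (set_fun \<mu>) (\<alpha> -` E)"
proof -
  note hom = homeomorphic_map_euclideanD[OF \<alpha>]
  have m\<alpha>: "\<alpha> \<in> measurable borel borel" and mi: "inv \<alpha> \<in> measurable borel borel"
    by (rule borel_measurable_continuous_onI[OF hom(2)], rule borel_measurable_continuous_onI[OF hom(3)])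
  define push where "push = (\<lambda>F. set_fun \<mu> (\<alpha> -` F))"
  define g where "g t = complex_of_real (w (inv \<alpha> t))" for t
  define \<nu> where "\<nu> = (\<lambda>E. if E \<in> sets borel
    then cmeasure_integral push (\<lambda>t. indicator E t *\<^sub>R g t) else 0)"
  have push: "borel_vector_measure push"
    unfolding push_def by (rule borel_vector_measure_push[OF borel_vector_measure_set_fun m\<alpha>])
  have push_le: "variation push E \<le> variation (set_fun \<mu>) (\<alpha> -` E)" for E
    unfolding push_def by (rule variation_push_le[OF m\<alpha>])
  have fin: "variation push UNIV < \<infinity>"
    using le_less_trans[OF push_le[of UNIV]] variation_set_fun_finite[of \<mu>] by simp
  have g: "g \<in> borel_measurable borel" "\<And>x. norm (g x) \<le> C"
    unfolding g_def[abs_def] using measurable_compose[OF mi w(1)] w(2)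
    by (simp_all add: borel_measurable_of_real)
  have \<nu>: "borel_vector_measure \<nu>"
    unfolding \<nu>_def
    by (rule borel_vector_measure_integral[OF bounded_borel_functional_cmeasure_integral[OF push fin] g])
  have le: "variation \<nu> E \<le> ennreal (4 * C) * variation (set_fun \<mu>) (\<alpha> -` E)"
    if E: "E \<in> sets borel" for E
  proof -
    have "emeasure (total_variation \<nu>) E \<le>
        emeasure (scale_measure (ennreal (4 * C)) (total_variation push)) E"
    proof (rule total_variation_le_of_norm_le[OF \<nu> E])
      fix A :: "'a set" assume A: "A \<in> sets borel"
      then show "ennreal (norm (\<nu> A)) \<le>
          emeasure (scale_measure (ennreal (4 * C)) (total_variation push)) A"
        using norm_cmeasure_integral_le[OF push fin g A]
        by (simp add: \<nu>_def emeasure_total_variation[OF push A])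
    qed simp
    then have "variation \<nu> E \<le> ennreal (4 * C) * variation push E"
      by (simp add: emeasure_total_variation \<nu> push E)
    also have "\<dots> \<le> ennreal (4 * C) * variation (set_fun \<mu>) (\<alpha> -` E)"
      by (intro mult_left_mono push_le) simp
    finally show ?thesis .
  qed
  have "\<nu> \<in> complex_radon_measures"
  proof (rule complex_radon_measures_dominated[OF set_fun \<nu> _ _ _ le])
    show "compact (\<alpha> ` K)" if "compact K" for K
      using compact_continuous_image[OF continuous_on_subset[OF hom(2) subset_UNIV] that] .
    show "\<alpha> -` E \<in> sets borel" if "E \<in> sets borel" for E
      using measurable_sets[OF m\<alpha> that] by simp
  qed (simp_all add: \<nu>_def)
  then have *: "set_fun (weighted_composition_adjoint \<alpha> w \<mu>) = \<nu>"
    unfolding weighted_composition_adjoint_def \<nu>_def push_def g_def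
    by (rule Complex_Radon_Measure_inverse)
  show "E \<in> sets borel \<Longrightarrow> set_fun (weighted_composition_adjoint \<alpha> w \<mu>) E =
      cmeasure_integral (\<lambda>F. set_fun \<mu> (\<alpha> -` F)) (\<lambda>t. indicator E t *\<^sub>R of_real (w (inv \<alpha> t)))"
    unfolding * by (simp add: \<nu>_def push_def g_def)
  show "E \<in> sets borel \<Longrightarrow> variation (set_fun (weighted_composition_adjoint \<alpha> w \<mu>)) E
      \<le> ennreal (4 * C) * variation (set_fun \<mu>) (\<alpha> -` E)"
    unfolding * by (rule le)
qed

lemma set_fun_weighted_composition_adjoint':
  fixes \<alpha> :: "'a::t2_space \<Rightarrow> 'a" and w :: "'a \<Rightarrow> real"
  assumes \<alpha>: "homeomorphic_map euclidean euclidean \<alpha>"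
    and w: "w \<in> borel_measurable borel" "\<And>x. \<bar>w x\<bar> \<le> C" and E: "E \<in> sets borel"
  shows "set_fun (weighted_composition_adjoint \<alpha> w \<mu>) E =
    cmeasure_integral (set_fun \<mu>) (weighted_composition \<alpha> w (indicator E))"
proof -
  note hom = homeomorphic_map_euclideanD[OF \<alpha>]
  have m\<alpha>: "\<alpha> \<in> measurable borel borel" and mi: "inv \<alpha> \<in> measurable borel borel"
    by (rule borel_measurable_continuous_onI[OF hom(2)], rule borel_measurable_continuous_onI[OF hom(3)])
  have C: "0 \<le> C" using w(2) abs_ge_zero order_trans by blast
  define f where "f t = indicator E t *\<^sub>R complex_of_real (w (inv \<alpha> t))" for t
  have "(\<lambda>t. complex_of_real (w (inv \<alpha> t))) \<in> borel_measurable borel"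
    using measurable_compose[OF mi w(1)] by simp
  then have f: "f \<in> borel_measurable borel" "\<And>x. norm (f x) \<le> C"
    unfolding f_def[abs_def] using E w(2) C
    by (auto intro!: borel_measurable_scaleR borel_measurable_indicator simp: indicator_def)
  have "(\<lambda>x. f (\<alpha> x)) = weighted_composition \<alpha> w (indicator E)"
    using hom(1) by (auto simp: f_def weighted_composition_def indicator_def bij_is_inj)
  then show ?thesis
    using cmeasure_integral_push[OF m\<alpha> f, of \<mu>]
    by (simp add: set_fun_weighted_composition_adjoint[OF \<alpha> w E] f_def)
qed

lemma bounded_borel_functional_weighted_composition:
  fixes \<mu> :: "'a::t2_space complex_radon_measure"
  assumes \<alpha>: "\<alpha> \<in> measurable borel borel"
    and w: "w \<in> borel_measurable borel" "\<And>x. \<bar>w x\<bar> \<le> C"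
  shows "bounded_borel_functional (\<lambda>f. cmeasure_integral (set_fun \<mu>) (weighted_composition \<alpha> w f))"
proof -
  have "(\<lambda>t. complex_of_real (w t)) \<in> borel_measurable borel" "\<And>x. norm (complex_of_real (w x)) \<le> C"
    using w by simp_all
  from bounded_borel_functional_reindex[OF bounded_borel_functional_cmeasure_integral[OF
      borel_vector_measure_set_fun variation_set_fun_finite] this \<alpha>]
  show ?thesis unfolding weighted_composition_def .
qed

theorem weighted_composition_adjoint_duality:
  fixes \<alpha> :: "'a::t2_space \<Rightarrow> 'a" and w :: "'a \<Rightarrow> real" and f :: "'a \<Rightarrow> complex"
  assumes \<alpha>: "homeomorphic_map euclidean euclidean \<alpha>"
    and w: "w \<in> borel_measurable borel" "\<And>x. \<bar>w x\<bar> \<le> C"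
    and f: "f \<in> borel_measurable borel" "\<And>x. norm (f x) \<le> D"
  shows "cmeasure_integral (set_fun (weighted_composition_adjoint \<alpha> w \<mu>)) f =
    cmeasure_integral (set_fun \<mu>) (weighted_composition \<alpha> w f)"
proof (rule bounded_borel_functional_eqI[OF _ _ _ f])
  note hom = homeomorphic_map_euclideanD[OF \<alpha>]
  have m\<alpha>: "\<alpha> \<in> measurable borel borel"
    using hom(2) by (rule borel_measurable_continuous_onI)
  show "bounded_borel_functional (cmeasure_integral (set_fun (weighted_composition_adjoint \<alpha> w \<mu>)))"
    by (rule bounded_borel_functional_cmeasure_integral[OF borel_vector_measure_set_fun variation_set_fun_finite])
  show "bounded_borel_functional (\<lambda>f. cmeasure_integral (set_fun \<mu>) (weighted_composition \<alpha> w f))"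
    by (rule bounded_borel_functional_weighted_composition[OF m\<alpha> w])
  fix E :: "'a set" assume E: "E \<in> sets borel"
  show "cmeasure_integral (set_fun (weighted_composition_adjoint \<alpha> w \<mu>)) (indicator E) =
      cmeasure_integral (set_fun \<mu>) (weighted_composition \<alpha> w (indicator E))"
    by (simp add: cmeasure_integral_indicator[OF borel_vector_measure_set_fun variation_set_fun_finite E]
        set_fun_weighted_composition_adjoint'[OF \<alpha> w E])
qed

lemma cmeasure_integral_set_fun_add:
  fixes f :: "'a::t2_space \<Rightarrow> complex"
  assumes f: "f \<in> borel_measurable borel" "\<And>x. norm (f x) \<le> D"
  shows "cmeasure_integral (set_fun (\<mu> + \<nu>)) f
    = cmeasure_integral (set_fun \<mu>) f + cmeasure_integral (set_fun \<nu>) f"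
proof (rule bounded_borel_functional_eqI[OF _ _ _ f])
  note bbf = bounded_borel_functional_cmeasure_integral[OF borel_vector_measure_set_fun variation_set_fun_finite]
  show "bounded_borel_functional (cmeasure_integral (set_fun (\<mu> + \<nu>)))" by (rule bbf)
  show "bounded_borel_functional (\<lambda>f. cmeasure_integral (set_fun \<mu>) f + cmeasure_integral (set_fun \<nu>) f)"
    unfolding bounded_borel_functional_def
  proof (intro conjI allI impI)
    fix f g :: "'a \<Rightarrow> complex" and C
    assume "f \<in> borel_measurable borel" "g \<in> borel_measurable borel"
      "\<forall>x. norm (f x) \<le> C" "\<forall>x. norm (g x) \<le> C"
    then show "cmeasure_integral (set_fun \<mu>) (\<lambda>x. f x + g x) + cmeasure_integral (set_fun \<nu>) (\<lambda>x. f x + g x) =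
      cmeasure_integral (set_fun \<mu>) f + cmeasure_integral (set_fun \<nu>) f +
      (cmeasure_integral (set_fun \<mu>) g + cmeasure_integral (set_fun \<nu>) g)"
      by (simp add: bounded_borel_functional_add[OF bbf, where C = C and D = C])
  next
    fix f :: "'a \<Rightarrow> complex" and c C
    assume "f \<in> borel_measurable borel" "\<forall>x. norm (f x) \<le> C"
    then show "cmeasure_integral (set_fun \<mu>) (\<lambda>x. c * f x) + cmeasure_integral (set_fun \<nu>) (\<lambda>x. c * f x) =
      c * (cmeasure_integral (set_fun \<mu>) f + cmeasure_integral (set_fun \<nu>) f)"
      by (simp add: bounded_borel_functional_mult[OF bbf, where C = C] distrib_left)
  next
    fix F :: "nat \<Rightarrow> 'a \<Rightarrow> complex" and f C
    assume "\<forall>n. F n \<in> borel_measurable borel" "\<forall>n x. norm (F n x) \<le> C" "\<forall>x. (\<lambda>n. F n x) \<longlonglongrightarrow> f x"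
    then show "(\<lambda>n. cmeasure_integral (set_fun \<mu>) (F n) + cmeasure_integral (set_fun \<nu>) (F n)) \<longlonglongrightarrow>
      cmeasure_integral (set_fun \<mu>) f + cmeasure_integral (set_fun \<nu>) f"
      by (intro tendsto_add bounded_borel_functional_lim[OF bbf, where C = C]) auto
  qed
  fix E :: "'a set" assume E: "E \<in> sets borel"
  note ind = cmeasure_integral_indicator[OF borel_vector_measure_set_fun variation_set_fun_finite E]
  show "cmeasure_integral (set_fun (\<mu> + \<nu>)) (indicator E) =
      cmeasure_integral (set_fun \<mu>) (indicator E) + cmeasure_integral (set_fun \<nu>) (indicator E)"
    unfolding ind by (rule set_fun_simps)
qed

lemma cmeasure_integral_set_fun_scaleR:
  fixes f :: "'a::t2_space \<Rightarrow> complex"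
  assumes f: "f \<in> borel_measurable borel" "\<And>x. norm (f x) \<le> D"
  shows "cmeasure_integral (set_fun (c *\<^sub>R \<mu>)) f = c *\<^sub>R cmeasure_integral (set_fun \<mu>) f"
proof -
  note bbf = bounded_borel_functional_cmeasure_integral[OF borel_vector_measure_set_fun variation_set_fun_finite]
  have one: "id \<in> measurable borel borel" "(\<lambda>_. of_real c) \<in> borel_measurable borel"
    "\<And>x::'a. norm (of_real c :: complex) \<le> \<bar>c\<bar>" by simp_all
  have "cmeasure_integral (set_fun (c *\<^sub>R \<mu>)) f = cmeasure_integral (set_fun \<mu>) (\<lambda>x. of_real c * f (id x))"
  proof (rule bounded_borel_functional_eqI[OF bbf bounded_borel_functional_reindex[OF bbf one(2,3,1)] _ f])
    fix E :: "'a set" assume E: "E \<in> sets borel"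
    have "cmeasure_integral (set_fun \<mu>) (\<lambda>x. of_real c * indicator E x)
        = of_real c * cmeasure_integral (set_fun \<mu>) (indicator E)"
      by (rule bounded_borel_functional_mult[OF bbf borel_measurable_indicator[OF E], where C = 1])
        (simp add: indicator_def)
    then show "cmeasure_integral (set_fun (c *\<^sub>R \<mu>)) (indicator E) =
        cmeasure_integral (set_fun \<mu>) (\<lambda>x. of_real c * indicator E (id x))"
      by (simp add: cmeasure_integral_indicator[OF borel_vector_measure_set_fun variation_set_fun_finite E]
          scaleR_conv_of_real)
  qed
  also have "\<dots> = of_real c * cmeasure_integral (set_fun \<mu>) f"
    using bounded_borel_functional_mult[OF bbf f] by simp
  finally show ?thesis by (simp add: scaleR_conv_of_real)
qed

lemma bounded_linear_weighted_composition_adjoint: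
  fixes \<alpha> :: "'a::t2_space \<Rightarrow> 'a" and w :: "'a \<Rightarrow> real"
  assumes \<alpha>: "homeomorphic_map euclidean euclidean \<alpha>"
    and w: "w \<in> borel_measurable borel" "\<And>x. \<bar>w x\<bar> \<le> C"
  shows "bounded_linear (weighted_composition_adjoint \<alpha> w)"
proof (rule bounded_linear_intro)
  have m\<alpha>: "\<alpha> \<in> measurable borel borel"
    using homeomorphic_map_euclideanD(2)[OF \<alpha>] by (rule borel_measurable_continuous_onI)
  have C: "0 \<le> C" using w(2) abs_ge_zero order_trans by blast
  have f: "weighted_composition \<alpha> w (indicator E) \<in> borel_measurable borel"
      "norm (weighted_composition \<alpha> w (indicator E) x) \<le> C" if "E \<in> sets borel" for E x
  proof -
    have "(\<lambda>t. complex_of_real (w t)) \<in> borel_measurable borel" using w(1) by simp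
    then show "weighted_composition \<alpha> w (indicator E) \<in> borel_measurable borel"
      unfolding weighted_composition_def
      using measurable_compose[OF m\<alpha> borel_measurable_indicator[OF that]]
      by (rule borel_measurable_times)
    show "norm (weighted_composition \<alpha> w (indicator E) x) \<le> C"
      using w(2)[of x] C by (simp add: weighted_composition_def norm_mult indicator_def)
  qed
  show "weighted_composition_adjoint \<alpha> w (\<mu> + \<nu>) =
      weighted_composition_adjoint \<alpha> w \<mu> + weighted_composition_adjoint \<alpha> w \<nu>" for \<mu> \<nu>
  proof (rule complex_radon_measure_eqI)
    fix E :: "'a set" assume E: "E \<in> sets borel"
    show "set_fun (weighted_composition_adjoint \<alpha> w (\<mu> + \<nu>)) E =
        set_fun (weighted_composition_adjoint \<alpha> w \<mu> + weighted_composition_adjoint \<alpha> w \<nu>) E"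
      using cmeasure_integral_set_fun_add[OF f[OF E], of \<mu> \<nu>]
      by (simp add: set_fun_weighted_composition_adjoint'[OF \<alpha> w E])
  qed
  show "weighted_composition_adjoint \<alpha> w (c *\<^sub>R \<mu>) = c *\<^sub>R weighted_composition_adjoint \<alpha> w \<mu>" for c \<mu>
  proof (rule complex_radon_measure_eqI)
    fix E :: "'a set" assume E: "E \<in> sets borel"
    show "set_fun (weighted_composition_adjoint \<alpha> w (c *\<^sub>R \<mu>)) E =
        set_fun (c *\<^sub>R weighted_composition_adjoint \<alpha> w \<mu>) E"
      using cmeasure_integral_set_fun_scaleR[OF f[OF E], of c \<mu>]
      by (simp add: set_fun_weighted_composition_adjoint'[OF \<alpha> w E])
  qed
  show "norm (weighted_composition_adjoint \<alpha> w \<mu>) \<le> norm \<mu> * (4 * C)" for \<mu>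
  proof -
    have n: "0 \<le> norm \<mu>" by (simp add: norm_complex_radon_measure_def)
    have "ennreal (norm (weighted_composition_adjoint \<alpha> w \<mu>)) \<le> ennreal (4 * C) * ennreal (norm \<mu>)"
      using variation_weighted_composition_adjoint[OF \<alpha> w, of UNIV \<mu>]
      by (simp add: ennreal_norm_complex_radon_measure)
    also have "\<dots> = ennreal (norm \<mu> * (4 * C))" using C n by (simp add: mult.commute flip: ennreal_mult)
    finally show ?thesis using C n by simp
  qed
qed


section \<open>Aperiodicity and topological hyper-transitivity\<close>

definition aperiodic :: "('a::topological_space \<Rightarrow> 'a) \<Rightarrow> bool" where
  "aperiodic \<alpha> \<longleftrightarrow> (\<forall>K. compact K \<longrightarrow> (\<exists>N>0. \<forall>n\<ge>N. K \<inter> (\<alpha> ^^ n) ` K = {}))"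

definition topologically_hyper_transitive :: "('x::banach \<Rightarrow> 'x) \<Rightarrow> bool" where
  "topologically_hyper_transitive T \<longleftrightarrow>
     (\<forall>U V. open U \<longrightarrow> U \<noteq> {} \<longrightarrow> open V \<longrightarrow> V \<noteq> {} \<longrightarrow>
        (\<exists>n :: nat \<Rightarrow> nat. strict_mono n \<and> (\<forall>k. 0 < n k) \<and> (\<forall>k. (T ^^ n k) ` U \<inter> V \<noteq> {})))"

end

theory Submission
  imports Defs
begin

text \<open>
  The \<open>n\<close>-th power of the adjoint is again a weighted composition adjoint, with weight
  \<open>P n = \<Prod>j<n. w \<circ> \<alpha>\<^sup>j\<close>, and that of its inverse has weight \<open>Q n = \<Prod>1\<le>j\<le>n. 1 / (w \<circ> \<alpha>\<^sup>-\<^sup>j)\<close>, where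
  \<open>Q n \<circ> \<alpha>\<^sup>n = 1 / P n\<close>.  If the adjoint \<open>T\<close> is transitive, some \<open>\<eta>\<close> close to \<open>\<mu>\<close> has \<open>T\<^sup>n \<eta>\<close> close to
  \<open>\<nu>\<close>; as \<open>\<nu>\<close> lives on \<open>K\<close>, which is disjoint from \<open>\<alpha>\<^sup>n K\<close>, the measure \<open>T\<^sup>n \<eta>\<close> is small on \<open>\<alpha>\<^sup>n K\<close>, so
  \<open>\<eta>\<close> and then \<open>\<mu>\<close> are small where \<open>P n\<close> is not.  The same argument for \<open>T\<^sup>-\<^sup>n\<close> handles \<open>\<nu>\<close> and \<open>Q n\<close>.
  Conversely, measures living on compact sets are dense, and for such \<open>\<mu>, \<nu>\<close> the orbit of
  \<open>\<mu>|\<^bsub>K - A\<^esub> + T\<^sup>-\<^sup>n (\<nu>|\<^bsub>K - B\<^esub>)\<close> starts near \<open>\<mu>\<close> and is near \<open>\<nu>\<close> after \<open>n\<close> steps.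
  All constants are crude: the available norm bound for the adjoint carries a factor \<open>4\<close>.
\<close>

section \<open>Composition, restriction and norm bounds\<close>

lemma borel_measurable_homeomorphic_map:
  assumes "homeomorphic_map euclidean euclidean (\<alpha> :: 'a::t2_space \<Rightarrow> 'a)"
  shows "\<alpha> \<in> measurable borel borel"
  by (rule borel_measurable_continuous_onI[OF homeomorphic_map_euclideanD(2)[OF assms]])

lemma weighted_composition_borel_bounded:
  assumes \<beta>: "\<beta> \<in> measurable borel borel"
    and g: "g \<in> borel_measurable borel" "\<And>x. \<bar>g x\<bar> \<le> C"
    and f: "f \<in> borel_measurable borel" "\<And>x. norm (f x) \<le> D"
  shows "weighted_composition \<beta> g f \<in> borel_measurable borel"
    and "norm (weighted_composition \<beta> g f x) \<le> C * D"
proof -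
  have "(\<lambda>t. complex_of_real (g t)) \<in> borel_measurable borel" using g(1) by simp
  then show "weighted_composition \<beta> g f \<in> borel_measurable borel"
    unfolding weighted_composition_def
    using measurable_compose[OF \<beta> f(1)] by (rule borel_measurable_times)
  have "0 \<le> C" using g(2) abs_ge_zero order_trans by blast
  then show "norm (weighted_composition \<beta> g f x) \<le> C * D"
    using g(2)[of x] f(2)[of "\<beta> x"] by (simp add: weighted_composition_def norm_mult mult_mono)
qed

text \<open>Duality moves the inner adjoint onto the integrand, so the operators on functions
  compose in the reverse order. The integrand is a pulled-back indicator, in general not continuous,
  which is why duality is used for all bounded Borel functions. Every later identity between
  operators is an instance of this law.\<close>

lemma weighted_composition_adjoint_compose:
  fixes \<beta> \<gamma> :: "'a::t2_space \<Rightarrow> 'a"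
  assumes \<beta>: "homeomorphic_map euclidean euclidean \<beta>"
    and g: "g \<in> borel_measurable borel" "\<And>x. \<bar>g x\<bar> \<le> C"
    and \<gamma>: "homeomorphic_map euclidean euclidean \<gamma>"
    and h: "h \<in> borel_measurable borel" "\<And>x. \<bar>h x\<bar> \<le> D"
  shows "weighted_composition_adjoint \<beta> g (weighted_composition_adjoint \<gamma> h \<mu>) =
    weighted_composition_adjoint (\<beta> \<circ> \<gamma>) (\<lambda>t. h t * g (\<gamma> t)) \<mu>"
proof (rule complex_radon_measure_eqI)
  fix E :: "'a set" assume E: "E \<in> sets borel"
  note m\<beta> = borel_measurable_homeomorphic_map[OF \<beta>] and m\<gamma> = borel_measurable_homeomorphic_map[OF \<gamma>]
  have \<beta>\<gamma>: "homeomorphic_map euclidean euclidean (\<beta> \<circ> \<gamma>)"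
    by (rule homeomorphic_map_compose[OF \<gamma> \<beta>])
  have "0 \<le> D" using h(2) abs_ge_zero order_trans by blast
  then have hg: "(\<lambda>t. h t * g (\<gamma> t)) \<in> borel_measurable borel" "\<And>x. \<bar>h x * g (\<gamma> x)\<bar> \<le> D * C"
    using h g measurable_compose[OF m\<gamma> g(1)] by (auto simp: abs_mult intro!: mult_mono)
  have ind: "indicator E \<in> borel_measurable borel" "\<And>x. norm (indicator E x :: complex) \<le> 1"
    using E by (auto simp: indicator_def)
  have "set_fun (weighted_composition_adjoint \<beta> g (weighted_composition_adjoint \<gamma> h \<mu>)) E =
      cmeasure_integral (set_fun \<mu>) (weighted_composition \<gamma> h (weighted_composition \<beta> g (indicator E)))"
    unfolding set_fun_weighted_composition_adjoint'[OF \<beta> g E]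
    by (rule weighted_composition_adjoint_duality[OF \<gamma> h weighted_composition_borel_bounded[OF m\<beta> g ind]])
  also have "weighted_composition \<gamma> h (weighted_composition \<beta> g (indicator E)) =
      weighted_composition (\<beta> \<circ> \<gamma>) (\<lambda>t. h t * g (\<gamma> t)) (indicator E)"
    by (simp add: weighted_composition_def fun_eq_iff)
  finally show "set_fun (weighted_composition_adjoint \<beta> g (weighted_composition_adjoint \<gamma> h \<mu>)) E =
      set_fun (weighted_composition_adjoint (\<beta> \<circ> \<gamma>) (\<lambda>t. h t * g (\<gamma> t)) \<mu>) E"
    by (simp add: set_fun_weighted_composition_adjoint'[OF \<beta>\<gamma> hg E])
qed

lemma norm_weighted_composition_adjoint_le:
  fixes \<beta> :: "'a::t2_space \<Rightarrow> 'a"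
  assumes \<beta>: "homeomorphic_map euclidean euclidean \<beta>"
    and g: "g \<in> borel_measurable borel" "\<And>x. \<bar>g x\<bar> \<le> C"
  shows "norm (weighted_composition_adjoint \<beta> g \<mu>) \<le> 4 * C * norm \<mu>"
proof -
  have C: "0 \<le> C" using g(2) abs_ge_zero order_trans by blast
  have "ennreal (norm (weighted_composition_adjoint \<beta> g \<mu>)) \<le> ennreal (4 * C) * ennreal (norm \<mu>)"
    using variation_weighted_composition_adjoint[OF \<beta> g, of UNIV \<mu>]
    by (simp add: ennreal_norm_complex_radon_measure)
  also have "\<dots> = ennreal (4 * C * norm \<mu>)" using C by (simp flip: ennreal_mult)
  finally show ?thesis using C by simp
qed

section \<open>Restriction of a Radon measure to a Borel set\<close>

text \<open>Encoding the restriction as an adjoint with symbol \<open>id\<close> makes regularity,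
  linearity and the interplay with \<open>weighted_composition_adjoint\<close> consequences of
  results on adjoints.\<close>

definition restrict_radon :: "'a::t2_space set \<Rightarrow> 'a complex_radon_measure \<Rightarrow> 'a complex_radon_measure"
  where "restrict_radon E = weighted_composition_adjoint id (indicator E)"

lemma homeomorphic_map_euclidean_id: "homeomorphic_map euclidean euclidean id"
  by simp

lemma indicator_borel_bounded:
  assumes "E \<in> sets borel"
  shows "indicat_real E \<in> borel_measurable borel" "\<And>x. \<bar>indicat_real E x\<bar> \<le> 1"
  using assms by (auto simp: indicator_def)

lemma bounded_linear_restrict_radon:
  "E \<in> sets borel \<Longrightarrow> bounded_linear (restrict_radon E)"
  unfolding restrict_radon_def
  by (rule bounded_linear_weighted_composition_adjoint[OF homeomorphic_map_euclidean_id indicator_borel_bounded])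

lemma set_fun_restrict_radon:
  assumes "E \<in> sets borel" "F \<in> sets borel"
  shows "set_fun (restrict_radon E \<mu>) F = set_fun \<mu> (E \<inter> F)"
proof -
  have "weighted_composition id (indicator E) (indicator F) = indicator (E \<inter> F)"
    by (auto simp: weighted_composition_def indicator_def)
  then show ?thesis
    using assms unfolding restrict_radon_def
      set_fun_weighted_composition_adjoint'[OF homeomorphic_map_euclidean_id indicator_borel_bounded[OF assms(1)] assms(2)]
    by (simp add: cmeasure_integral_indicator[OF borel_vector_measure_set_fun variation_set_fun_finite])
qed

lemma restrict_radon_UNIV [simp]: "restrict_radon UNIV \<mu> = \<mu>"
  by (rule complex_radon_measure_eqI) (simp add: set_fun_restrict_radon)

lemma restrict_radon_empty [simp]: "restrict_radon {} \<mu> = 0"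
  by (rule complex_radon_measure_eqI)
    (simp add: set_fun_restrict_radon borel_vector_measure_empty[OF borel_vector_measure_set_fun])

lemma restrict_radon_restrict_radon:
  assumes "E \<in> sets borel" "F \<in> sets borel"
  shows "restrict_radon E (restrict_radon F \<mu>) = restrict_radon (F \<inter> E) \<mu>"
  by (rule complex_radon_measure_eqI) (use assms in \<open>simp add: set_fun_restrict_radon Int_assoc\<close>)

lemma restrict_radon_add_Compl:
  assumes "E \<in> sets borel"
  shows "restrict_radon E \<mu> + restrict_radon (- E) \<mu> = \<mu>"
proof (rule complex_radon_measure_eqI)
  fix F :: "'a set" assume F: "F \<in> sets borel"
  have "set_fun \<mu> ((E \<inter> F) \<union> (- E \<inter> F)) = set_fun \<mu> (E \<inter> F) + set_fun \<mu> (- E \<inter> F)"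
    using assms F by (intro borel_vector_measure_disjoint_union[OF borel_vector_measure_set_fun]) auto
  moreover have "(E \<inter> F) \<union> (- E \<inter> F) = F" by blast
  ultimately show "set_fun (restrict_radon E \<mu> + restrict_radon (- E) \<mu>) F = set_fun \<mu> F"
    using assms F by (simp add: set_fun_restrict_radon)
qed

text \<open>Translates values of the total variation into norms. A partition of \<open>E\<close> is
  seen identically by both measures, and a partition of the whole space becomes one of
  \<open>E\<close> after intersection. Comparing variations directly gives an equality, whereas the
  general norm bound would lose a factor 4.\<close>

lemma emeasure_abs_measure_eq_norm:
  assumes E: "E \<in> sets borel"
  shows "emeasure (abs_measure \<mu>) E = ennreal (norm (restrict_radon E \<mu>))"
proof -
  let ?\<rho> = "restrict_radon E \<mu>"
  have "variation (set_fun \<mu>) E \<le> variation (set_fun ?\<rho>) E"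
  proof (rule variation_least)
    fix A :: "nat \<Rightarrow> 'a set"
    assume A: "range A \<subseteq> sets borel" "disjoint_family A" "(\<Union>n. A n) = E"
    have "A n \<in> sets borel" "E \<inter> A n = A n" for n using A by auto
    then have "set_fun \<mu> (A n) = set_fun ?\<rho> (A n)" for n using E by (simp add: set_fun_restrict_radon)
    then show "(\<Sum>n. ennreal (norm (set_fun \<mu> (A n)))) \<le> variation (set_fun ?\<rho>) E"
      using variation_upper[OF A, of "set_fun ?\<rho>"] by simp
  qed
  also have "\<dots> \<le> variation (set_fun ?\<rho>) UNIV"
    using E by (intro variation_mono borel_vector_measure_set_fun) auto
  finally have 1: "variation (set_fun \<mu>) E \<le> variation (set_fun ?\<rho>) UNIV" .
  have 2: "variation (set_fun ?\<rho>) UNIV \<le> variation (set_fun \<mu>) E"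
  proof (rule variation_least)
    fix A :: "nat \<Rightarrow> 'a set"
    assume A: "range A \<subseteq> sets borel" "disjoint_family A" "(\<Union>n. A n) = UNIV"
    have "A n \<in> sets borel" for n using A by auto
    then have "set_fun ?\<rho> (A n) = set_fun \<mu> (E \<inter> A n)" for n
      using E by (simp add: set_fun_restrict_radon)
    moreover have "(\<Sum>n. ennreal (norm (set_fun \<mu> (E \<inter> A n)))) \<le> variation (set_fun \<mu>) E"
      by (rule variation_upper) (use A E in \<open>auto simp: disjoint_family_on_def\<close>)
    ultimately show "(\<Sum>n. ennreal (norm (set_fun ?\<rho> (A n)))) \<le> variation (set_fun \<mu>) E" by simp
  qed
  show ?thesis
    using 1 2 by (simp add: emeasure_abs_measure[OF E] ennreal_norm_complex_radon_measure)
qed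

lemma norm_restrict_radon_mono:
  assumes "E \<in> sets borel" "F \<in> sets borel" "E \<subseteq> F"
  shows "norm (restrict_radon E \<mu>) \<le> norm (restrict_radon F \<mu>)"
  using emeasure_mono[OF assms(3), of "abs_measure \<mu>"] assms
  by (simp add: emeasure_abs_measure_eq_norm)

lemma norm_restrict_radon_le:
  assumes "E \<in> sets borel"
  shows "norm (restrict_radon E \<mu>) \<le> norm \<mu>"
  using norm_restrict_radon_mono[OF assms, of UNIV \<mu>] by simp

lemma norm_restrict_radon_le_add:
  assumes "E \<in> sets borel"
  shows "norm (restrict_radon E \<mu>) \<le> norm (restrict_radon E \<nu>) + norm (\<mu> - \<nu>)"
proof -
  have "restrict_radon E \<mu> = restrict_radon E \<nu> + restrict_radon E (\<mu> - \<nu>)"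
    using linear_diff[OF bounded_linear.linear[OF bounded_linear_restrict_radon[OF assms]]] by simp
  then show ?thesis
    using norm_triangle_ineq[of "restrict_radon E \<nu>" "restrict_radon E (\<mu> - \<nu>)"]
      norm_restrict_radon_le[OF assms, of "\<mu> - \<nu>"] by simp
qed

lemma weighted_composition_adjoint_restrict_radon:
  fixes \<beta> :: "'a::t2_space \<Rightarrow> 'a"
  assumes "homeomorphic_map euclidean euclidean \<beta>"
    and "g \<in> borel_measurable borel" "\<And>x. \<bar>g x\<bar> \<le> C" and "E \<in> sets borel"
  shows "weighted_composition_adjoint \<beta> g (restrict_radon E \<mu>) =
    weighted_composition_adjoint \<beta> (\<lambda>t. indicator E t * g t) \<mu>"
  unfolding restrict_radon_def
  by (subst weighted_composition_adjoint_compose[OF assms(1-3) homeomorphic_map_euclidean_id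
        indicator_borel_bounded[OF assms(4)]]) simp

text \<open>Only the size of the weight on \<open>E\<close> counts: the weight may be multiplied by
  the indicator of \<open>E\<close> before the norm bound is applied. The global bound
  \<open>C\<close> just ensures that the operator is well defined.\<close>

lemma norm_weighted_composition_adjoint_restrict_radon_le:
  fixes \<beta> :: "'a::t2_space \<Rightarrow> 'a"
  assumes \<beta>: "homeomorphic_map euclidean euclidean \<beta>"
    and g: "g \<in> borel_measurable borel" "\<And>x. \<bar>g x\<bar> \<le> C" and E: "E \<in> sets borel"
    and c: "0 \<le> c" "\<And>t. t \<in> E \<Longrightarrow> \<bar>g t\<bar> \<le> c"
  shows "norm (weighted_composition_adjoint \<beta> g (restrict_radon E \<mu>)) \<le> 4 * c * norm (restrict_radon E \<mu>)"
proof -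
  have m: "(\<lambda>t. indicator E t * g t) \<in> borel_measurable borel" "\<And>t. \<bar>indicator E t * g t\<bar> \<le> c"
    using g(1) E c by (auto simp: indicator_def)
  \<comment> \<open>Restricting twice keeps the restricted measure, and not \<open>\<mu>\<close>
    itself, on the right of the estimate.\<close>
  have "restrict_radon E \<mu> = restrict_radon E (restrict_radon E \<mu>)"
    using E by (simp add: restrict_radon_restrict_radon)
  then have "weighted_composition_adjoint \<beta> g (restrict_radon E \<mu>) =
      weighted_composition_adjoint \<beta> (\<lambda>t. indicator E t * g t) (restrict_radon E \<mu>)"
    by (metis weighted_composition_adjoint_restrict_radon[OF \<beta> g E])
  then show ?thesis using norm_weighted_composition_adjoint_le[OF \<beta> m] by simp
qed

text \<open>By the composition law, both sides are the adjoint with symbol \<open>\<beta>\<close>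
  and weight \<open>g\<close> cut off to the preimage of \<open>E\<close>.\<close>

lemma restrict_radon_weighted_composition_adjoint:
  fixes \<beta> :: "'a::t2_space \<Rightarrow> 'a"
  assumes \<beta>: "homeomorphic_map euclidean euclidean \<beta>"
    and g: "g \<in> borel_measurable borel" "\<And>x. \<bar>g x\<bar> \<le> C" and E: "E \<in> sets borel"
  shows "restrict_radon E (weighted_composition_adjoint \<beta> g \<mu>) =
    weighted_composition_adjoint \<beta> g (restrict_radon (\<beta> -` E) \<mu>)"
proof -
  have E': "\<beta> -` E \<in> sets borel"
    using measurable_sets[OF borel_measurable_homeomorphic_map[OF \<beta>] E] by simp
  have "(\<lambda>t. indicator (\<beta> -` E) t * g t) = (\<lambda>t. g t * indicat_real E (\<beta> t))"
    by (auto simp: indicator_def)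
  then show ?thesis
    unfolding weighted_composition_adjoint_restrict_radon[OF \<beta> g E']
    unfolding restrict_radon_def weighted_composition_adjoint_compose[OF homeomorphic_map_euclidean_id
        indicator_borel_bounded[OF E] \<beta> g] by simp
qed

text \<open>Inner regularity on the whole space yields a compact set for each measure, and their
  union serves both. This is the density of the measures living on compact sets.\<close>

lemma radon_inner_approximation:
  fixes \<mu> \<nu> :: "'a::t2_space complex_radon_measure"
  assumes "0 < e"
  obtains K where "compact K" "norm (\<mu> - restrict_radon K \<mu>) < e" "norm (\<nu> - restrict_radon K \<nu>) < e"
proof -
  have *: "\<exists>K. compact K \<and> norm (restrict_radon (- K) \<rho>) < e" for \<rho> :: "'a complex_radon_measure"
  proof -
    obtain K where K: "compact K" "variation (set_fun \<rho>) (UNIV - K) < ennreal e"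
      using complex_radon_measuresD(4)[OF set_fun _ assms, of UNIV \<rho>] by auto
    have m: "- K \<in> sets borel" using K(1) by (auto simp: compact_imp_closed)
    then have "ennreal (norm (restrict_radon (- K) \<rho>)) < ennreal e"
      using K(2) emeasure_abs_measure[OF m, of \<rho>]
      by (simp add: emeasure_abs_measure_eq_norm Compl_eq_Diff_UNIV)
    then show ?thesis using K(1) by (auto simp: ennreal_less_iff)
  qed
  obtain K L where KL: "compact K" "norm (restrict_radon (- K) \<mu>) < e"
      "compact L" "norm (restrict_radon (- L) \<nu>) < e"
    using *[of \<mu>] *[of \<nu>] by blast
  have c: "compact (K \<union> L)" using KL by auto
  have b: "K \<in> sets borel" "L \<in> sets borel" "K \<union> L \<in> sets borel"
    using KL c by (auto simp: compact_imp_closed)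
  have d: "\<rho> - restrict_radon (K \<union> L) \<rho> = restrict_radon (- (K \<union> L)) \<rho>" for \<rho>
    using restrict_radon_add_Compl[OF b(3), of \<rho>] by (metis add_diff_cancel_left')
  have "norm (restrict_radon (- (K \<union> L)) \<mu>) \<le> norm (restrict_radon (- K) \<mu>)"
    "norm (restrict_radon (- (K \<union> L)) \<nu>) \<le> norm (restrict_radon (- L) \<nu>)"
    using b by (intro norm_restrict_radon_mono; auto)+
  then show thesis using that[OF c] KL by (simp add: d)
qed

section \<open>Powers of the adjoint and of its inverse\<close>

lemma homeomorphic_map_funpow:
  "homeomorphic_map X X f \<Longrightarrow> homeomorphic_map X X (f ^^ n)"
  by (induction n) (auto intro: homeomorphic_map_compose simp: homeomorphic_map_id[simplified] simp flip: id_def)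

lemma homeomorphic_map_inv:
  fixes \<alpha> :: "'a::topological_space \<Rightarrow> 'a"
  assumes "homeomorphic_map euclidean euclidean \<alpha>"
  shows "homeomorphic_map euclidean euclidean (inv \<alpha>)"
proof -
  note D = homeomorphic_map_euclideanD[OF assms]
  have "homeomorphic_maps euclidean euclidean \<alpha> (inv \<alpha>)"
    using D by (auto simp: homeomorphic_maps_def bij_is_inj bij_is_surj surj_f_inv_f)
  then show ?thesis using homeomorphic_maps_map by blast
qed

lemma weight_product_borel_bounded:
  fixes \<alpha> :: "'a::t2_space \<Rightarrow> 'a" and w :: "'a \<Rightarrow> real"
  assumes \<alpha>: "homeomorphic_map euclidean euclidean \<alpha>"
    and w: "w \<in> borel_measurable borel" "\<And>x. \<bar>w x\<bar> \<le> C"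
  shows "(\<lambda>t. \<Prod>j=0..<n. w ((\<alpha> ^^ j) t)) \<in> borel_measurable borel"
    and "\<bar>\<Prod>j=0..<n. w ((\<alpha> ^^ j) t)\<bar> \<le> C ^ n"
proof -
  have "(\<lambda>t. w ((\<alpha> ^^ j) t)) \<in> borel_measurable borel" for j
    using measurable_compose[OF borel_measurable_homeomorphic_map[OF homeomorphic_map_funpow[OF \<alpha>]] w(1)] .
  then show "(\<lambda>t. \<Prod>j=0..<n. w ((\<alpha> ^^ j) t)) \<in> borel_measurable borel"
    by (intro borel_measurable_prod)
  have "(\<Prod>j=0..<n. \<bar>w ((\<alpha> ^^ j) t)\<bar>) \<le> (\<Prod>j=0..<n. C)"
    using w(2) by (intro prod_mono) auto
  then show "\<bar>\<Prod>j=0..<n. w ((\<alpha> ^^ j) t)\<bar> \<le> C ^ n" by (simp add: abs_prod)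
qed

lemma weighted_composition_adjoint_id [simp]: "weighted_composition_adjoint id (\<lambda>_. 1) \<mu> = \<mu>"
proof -
  have "indicat_real UNIV = (\<lambda>_. 1)" by auto
  then show ?thesis using restrict_radon_UNIV[of \<mu>] by (simp add: restrict_radon_def)
qed

lemma funpow_weighted_composition_adjoint:
  fixes \<alpha> :: "'a::t2_space \<Rightarrow> 'a" and w :: "'a \<Rightarrow> real"
  assumes \<alpha>: "homeomorphic_map euclidean euclidean \<alpha>"
    and w: "w \<in> borel_measurable borel" "\<And>x. \<bar>w x\<bar> \<le> C"
  shows "(weighted_composition_adjoint \<alpha> w ^^ n) \<mu> =
    weighted_composition_adjoint (\<alpha> ^^ n) (\<lambda>t. \<Prod>j=0..<n. w ((\<alpha> ^^ j) t)) \<mu>"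
proof (induction n)
  case 0
  show ?case by (simp flip: id_def)
next
  case (Suc n)
  show ?case
    \<comment> \<open>The outermost application of the adjoint contributes \<open>w\<close> at the
      \<open>n\<close>-th iterate, which is the last factor of the product of length
      \<open>Suc n\<close>.\<close>
    using weighted_composition_adjoint_compose[OF \<alpha> w homeomorphic_map_funpow[OF \<alpha>, of n]
        weight_product_borel_bounded[OF \<alpha> w, where n = n], of \<mu>]
    by (simp add: Suc comp_def)
qed

lemma funpow_left_inverse:
  fixes f g :: "'a \<Rightarrow> 'a"
  assumes "\<And>x. g (f x) = x"
  shows "(g ^^ n) ((f ^^ n) x) = x"
proof (induction n)
  case (Suc n)
  have "(g ^^ Suc n) ((f ^^ Suc n) x) = (g ^^ n) (g (f ((f ^^ n) x)))"
    by (simp only: funpow_Suc_right[of n g] funpow.simps(2)[where f = f] o_apply)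
  then show ?case by (simp add: assms Suc)
qed simp

lemma weight_product_inverse:
  fixes w :: "'a \<Rightarrow> real"
  assumes "bij \<alpha>"
  shows "(\<Prod>j=1..n. 1 / w ((inv \<alpha> ^^ j) ((\<alpha> ^^ n) t))) = 1 / (\<Prod>j=0..<n. w ((\<alpha> ^^ j) t))"
proof -
  have "(inv \<alpha> ^^ j) ((\<alpha> ^^ n) t) = (\<alpha> ^^ (n - j)) t" if "j \<le> n" for j
  proof -
    have "(inv \<alpha> ^^ j) ((\<alpha> ^^ j) ((\<alpha> ^^ (n - j)) t)) = (\<alpha> ^^ (n - j)) t"
      using assms by (intro funpow_left_inverse) (simp add: bij_is_inj)
    then show ?thesis using that by (metis comp_apply funpow_add le_add_diff_inverse)
  qed
  then have "(\<Prod>j=1..n. 1 / w ((inv \<alpha> ^^ j) ((\<alpha> ^^ n) t))) = (\<Prod>j=1..n. 1 / w ((\<alpha> ^^ (n - j)) t))"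
    by (intro prod.cong) auto
  \<comment> \<open>The reversal sending \<open>j\<close> to \<open>n - j\<close> carries the
    indices 1 to \<open>n\<close> onto 0 to \<open>n - 1\<close>.\<close>
  also have "\<dots> = (\<Prod>j=0..<n. 1 / w ((\<alpha> ^^ j) t))"
    by (rule prod.reindex_bij_witness[of _ "\<lambda>j. n - j" "\<lambda>j. n - j"]) auto
  finally show ?thesis by (simp add: prod_dividef)
qed

text \<open>As \<open>\<mu>\<close> lives on \<open>K\<close>, cutting it down to
  \<open>K - A\<close> removes exactly its part on \<open>A\<close>. This identifies the truncation
  error of the approximate orbit.\<close>

lemma diff_restrict_radon:
  assumes "K \<in> sets borel" "A \<in> sets borel" "A \<subseteq> K" "restrict_radon (- K) \<mu> = 0"
  shows "\<mu> - restrict_radon (K - A) \<mu> = restrict_radon A \<mu>"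
proof -
  have m: "K - A \<in> sets borel" using assms by auto
  have "restrict_radon K \<mu> = \<mu>" using restrict_radon_add_Compl[OF assms(1), of \<mu>] assms(4) by simp
  then have "restrict_radon (- (K - A)) \<mu> = restrict_radon (- (K - A)) (restrict_radon K \<mu>)" by simp
  also have "\<dots> = restrict_radon (K \<inter> - (K - A)) \<mu>"
    using m assms(1) by (intro restrict_radon_restrict_radon borel_comp)
  also have "K \<inter> - (K - A) = A" using assms(3) by blast
  finally show ?thesis using restrict_radon_add_Compl[OF m, of \<mu>] by (metis add_diff_cancel_left')
qed

text \<open>
  The set \<open>A\<close> is carried by \<open>\<gamma>\<close> from a set disjoint from \<open>K\<close>, where \<open>\<nu>\<close> vanishes and hence \<open>\<zeta>\<close> is
  small; so the image of \<open>\<zeta>\<close> is small on \<open>A\<close>, and \<open>\<mu>\<close> is close to that image.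
\<close>

lemma norm_restrict_radon_le_of_disjoint:
  fixes \<gamma> :: "'a::t2_space \<Rightarrow> 'a"
  assumes \<gamma>: "homeomorphic_map euclidean euclidean \<gamma>"
    and h: "h \<in> borel_measurable borel" "\<And>x. \<bar>h x\<bar> \<le> C"
    and sets: "K \<in> sets borel" "A \<in> sets borel" "A \<subseteq> K"
    and disj: "\<gamma> -` K \<inter> K = {}" and \<nu>: "restrict_radon (- K) \<nu> = 0"
    and c: "0 \<le> c" "\<And>s. \<gamma> s \<in> A \<Longrightarrow> \<bar>h s\<bar> \<le> c"
  shows "norm (restrict_radon A \<mu>) \<le>
    4 * c * norm (\<zeta> - \<nu>) + norm (\<mu> - weighted_composition_adjoint \<gamma> h \<zeta>)"
proof -
  have m: "\<gamma> -` A \<in> sets borel"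
    using measurable_sets[OF borel_measurable_homeomorphic_map[OF \<gamma>] sets(2)] by simp
  \<comment> \<open>The preimage of \<open>A\<close> lies in the preimage of \<open>K\<close>, hence
    outside \<open>K\<close>, where \<open>\<nu>\<close> vanishes.\<close>
  have "norm (restrict_radon (\<gamma> -` A) \<nu>) \<le> norm (restrict_radon (- K) \<nu>)"
    using m sets disj by (intro norm_restrict_radon_mono) auto
  then have "norm (restrict_radon (\<gamma> -` A) \<zeta>) \<le> norm (\<zeta> - \<nu>)"
    using norm_restrict_radon_le_add[OF m, of \<zeta> \<nu>] \<nu> by simp
  moreover have "norm (restrict_radon A (weighted_composition_adjoint \<gamma> h \<zeta>)) \<le>
      4 * c * norm (restrict_radon (\<gamma> -` A) \<zeta>)"
    unfolding restrict_radon_weighted_composition_adjoint[OF \<gamma> h sets(2)]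
    using c by (intro norm_weighted_composition_adjoint_restrict_radon_le[OF \<gamma> h m]) auto
  ultimately have "norm (restrict_radon A (weighted_composition_adjoint \<gamma> h \<zeta>)) \<le> 4 * c * norm (\<zeta> - \<nu>)"
    using mult_left_mono[of "norm (restrict_radon (\<gamma> -` A) \<zeta>)" "norm (\<zeta> - \<nu>)" "4 * c"] c(1) by simp
  then show ?thesis
    using norm_restrict_radon_le_add[OF sets(2), of \<mu> "weighted_composition_adjoint \<gamma> h \<zeta>"] by simp
qed

section \<open>The adjoint, its inverse and their weight products for a weight bounded above and
  away from zero\<close>

locale weighted_homeomorphism =
  fixes \<alpha> :: "'a::t2_space \<Rightarrow> 'a" and w :: "'a \<Rightarrow> real" and C D :: real
  assumes homeo: "homeomorphic_map euclidean euclidean \<alpha>"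
    and w_borel: "w \<in> borel_measurable borel"
    and w_pos: "0 < w t" and w_le: "w t \<le> C" and inverse_w_le: "1 / w t \<le> D"
begin

abbreviation T :: "'a complex_radon_measure \<Rightarrow> 'a complex_radon_measure"
  where "T \<equiv> weighted_composition_adjoint \<alpha> w"

text \<open>The inverse of \<open>T\<close>: its weight \<open>g\<close> solves
  \<open>w t * g (\<alpha> t) = 1\<close>.\<close>

abbreviation S :: "'a complex_radon_measure \<Rightarrow> 'a complex_radon_measure"
  where "S \<equiv> weighted_composition_adjoint (inv \<alpha>) (\<lambda>t. 1 / w (inv \<alpha> t))"

definition P :: "nat \<Rightarrow> 'a \<Rightarrow> real" where "P n t = (\<Prod>j=0..<n. w ((\<alpha> ^^ j) t))"

definition Q :: "nat \<Rightarrow> 'a \<Rightarrow> real" where "Q n t = (\<Prod>j=1..n. 1 / w ((inv \<alpha> ^^ j) t))"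

text \<open>Condition (ii) for one fixed choice of \<open>K\<close> and the two measures, worded so
  that the theorem can be folded into it. Suprema are taken in \<open>ennreal\<close>, where the
  supremum over the empty set is 0.\<close>

definition decay :: "'a set \<Rightarrow> 'a complex_radon_measure \<Rightarrow> 'a complex_radon_measure \<Rightarrow> bool" where
  "decay K \<mu> \<nu> \<longleftrightarrow>
    (\<exists>n A B. strict_mono (n :: nat \<Rightarrow> nat) \<and> (\<forall>k. 0 < n k) \<and>
      (\<forall>k. A k \<in> sets borel \<and> A k \<subseteq> K) \<and> (\<forall>k. B k \<in> sets borel \<and> B k \<subseteq> K) \<and>
      (\<forall>k. (\<alpha> ^^ n k) ` K \<inter> K = {}) \<and>
      (\<lambda>k. emeasure (abs_measure \<mu>) (A k)) \<longlonglongrightarrow> 0 \<and>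
      (\<lambda>k. emeasure (abs_measure \<nu>) (B k)) \<longlonglongrightarrow> 0 \<and>
      (\<lambda>k. SUP t\<in>K \<inter> - A k. ennreal (P (n k) t)) \<longlonglongrightarrow> 0 \<and>
      (\<lambda>k. SUP t\<in>K \<inter> - B k. ennreal (Q (n k) t)) \<longlonglongrightarrow> 0)"

lemma P_pos: "0 < P n t" and Q_pos: "0 < Q n t"
  by (simp_all add: P_def Q_def prod_pos w_pos)

lemma bij: "bij \<alpha>"
  by (rule homeomorphic_map_euclideanD(1)[OF homeo])

lemma inv_funpow: "(inv \<alpha> ^^ n) ((\<alpha> ^^ n) t) = t" "(\<alpha> ^^ n) ((inv \<alpha> ^^ n) t) = t"
  by (rule funpow_left_inverse, simp add: bij bij_is_inj bij_is_surj surj_f_inv_f)+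

lemmas homeo_inv = homeomorphic_map_inv[OF homeo]
lemmas homeo_funpow = homeomorphic_map_funpow[OF homeo]
lemmas homeo_inv_funpow = homeomorphic_map_funpow[OF homeo_inv]

lemma abs_w_le: "\<bar>w t\<bar> \<le> C"
  using w_pos[of t] w_le[of t] by simp

lemma inverse_weight_borel: "(\<lambda>t. 1 / w (inv \<alpha> t)) \<in> borel_measurable borel"
  using measurable_compose[OF borel_measurable_homeomorphic_map[OF homeo_inv] w_borel] by simp

lemma abs_inverse_weight_le: "\<bar>1 / w (inv \<alpha> t)\<bar> \<le> D"
  using w_pos[of "inv \<alpha> t"] inverse_w_le[of "inv \<alpha> t"] by simp

text \<open>Shifting the index by one turns \<open>Q\<close> into the same kind of product as
  \<open>P\<close>, for the inverse map and the weight of \<open>S\<close>, so the facts about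
  powers apply to both.\<close>

lemma Q_eq: "Q n t = (\<Prod>j=0..<n. 1 / w (inv \<alpha> ((inv \<alpha> ^^ j) t)))"
  by (simp add: Q_def prod.atLeast1_atMost_eq atLeast0LessThan)

lemma P_borel: "P n \<in> borel_measurable borel" and abs_P_le: "\<bar>P n t\<bar> \<le> C ^ n"
  and Q_borel: "Q n \<in> borel_measurable borel" and abs_Q_le: "\<bar>Q n t\<bar> \<le> D ^ n"
  using weight_product_borel_bounded[OF homeo w_borel abs_w_le, where n = n]
    weight_product_borel_bounded[OF homeo_inv inverse_weight_borel abs_inverse_weight_le, where n = n]
  by (simp_all add: P_def[abs_def] Q_eq[abs_def])

lemma T_funpow: "(T ^^ n) \<mu> = weighted_composition_adjoint (\<alpha> ^^ n) (P n) \<mu>"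
  by (simp add: P_def[abs_def] funpow_weighted_composition_adjoint[OF homeo w_borel abs_w_le])

lemma S_funpow: "(S ^^ n) \<mu> = weighted_composition_adjoint (inv \<alpha> ^^ n) (Q n) \<mu>"
  by (simp add: Q_eq[abs_def]
      funpow_weighted_composition_adjoint[OF homeo_inv inverse_weight_borel abs_inverse_weight_le])

lemma T_S: "T (S \<mu>) = \<mu>" and S_T: "S (T \<mu>) = \<mu>"
proof -
  have w0: "w t \<noteq> 0" for t using w_pos[of t] by simp
  have i: "\<alpha> \<circ> inv \<alpha> = id" "inv \<alpha> \<circ> \<alpha> = id"
    using bij by (simp_all add: bij_is_inj bij_is_surj flip: surj_iff)
  then have i': "inv \<alpha> (\<alpha> t) = t" for t by (metis comp_apply id_apply)
  show "T (S \<mu>) = \<mu>"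
    by (simp add: weighted_composition_adjoint_compose[OF homeo w_borel abs_w_le
          homeo_inv inverse_weight_borel abs_inverse_weight_le] i w0)
  show "S (T \<mu>) = \<mu>"
    by (simp add: weighted_composition_adjoint_compose[OF homeo_inv inverse_weight_borel
          abs_inverse_weight_le homeo w_borel abs_w_le] i i' w0)
qed

lemma T_S_funpow: "(T ^^ n) ((S ^^ n) \<mu>) = \<mu>" and S_T_funpow: "(S ^^ n) ((T ^^ n) \<mu>) = \<mu>"
  by (rule funpow_left_inverse, rule T_S, rule funpow_left_inverse, rule S_T)

lemma Q_funpow: "Q n ((\<alpha> ^^ n) t) = 1 / P n t"
  unfolding P_def Q_def by (rule weight_product_inverse[OF bij])

section \<open>Transitivity implies decay of the weight products\<close>

text \<open>One stage of the sequence in (ii): a single precision \<open>d\<close>, with an exponent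
  beyond any prescribed \<open>N\<close>.\<close>

lemma ex_small_sets:
  assumes T: "topologically_hyper_transitive T" and \<alpha>: "aperiodic \<alpha>"
    and K: "compact K" and \<mu>: "restrict_radon (- K) \<mu> = 0" and \<nu>: "restrict_radon (- K) \<nu> = 0"
    and d: "0 < d" "d \<le> 1"
  obtains n A B where "N < n" "A \<in> sets borel" "A \<subseteq> K" "B \<in> sets borel" "B \<subseteq> K"
    "(\<alpha> ^^ n) ` K \<inter> K = {}"
    "norm (restrict_radon A \<mu>) \<le> d" "norm (restrict_radon B \<nu>) \<le> d"
    "\<And>t. t \<in> K - A \<Longrightarrow> P n t \<le> d" "\<And>t. t \<in> K - B \<Longrightarrow> Q n t \<le> d"
proof -
  \<comment> \<open>Chosen so that \<open>4 * (1 / d) * e + e\<close>, which is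
    \<open>d / 2 + d * d / 8\<close>, is at most \<open>d\<close> when
    \<open>d \<le> 1\<close>.\<close>
  define e where "e = d\<^sup>2 / 8"
  have e: "0 < e" using d by (simp add: e_def)
  obtain N0 where N0: "\<And>n. N0 \<le> n \<Longrightarrow> K \<inter> (\<alpha> ^^ n) ` K = {}"
    using \<alpha> K unfolding aperiodic_def by blast
  have "ball \<mu> e \<noteq> {}" "ball \<nu> e \<noteq> {}" using e by auto
  then obtain m :: "nat \<Rightarrow> nat" where m: "strict_mono m" "\<And>k. (T ^^ m k) ` ball \<mu> e \<inter> ball \<nu> e \<noteq> {}"
    using T open_ball unfolding topologically_hyper_transitive_def by metis
  \<comment> \<open>A strictly increasing sequence dominates its index, so this exponent exceeds
    \<open>N\<close> and is past the aperiodicity threshold \<open>N0\<close>.\<close>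
  define n where "n = m (Suc (N + N0))"
  have n: "Suc (N + N0) \<le> n" unfolding n_def by (rule strict_mono_imp_increasing[OF m(1)])
  obtain \<eta> where \<eta>: "\<eta> \<in> ball \<mu> e" "(T ^^ n) \<eta> \<in> ball \<nu> e" using m(2)[of "Suc (N + N0)"] n_def by blast
  then have dist: "norm (\<mu> - \<eta>) \<le> e" "norm (\<eta> - \<mu>) \<le> e"
      "norm (\<nu> - (T ^^ n) \<eta>) \<le> e" "norm ((T ^^ n) \<eta> - \<nu>) \<le> e"
    by (simp_all add: dist_norm norm_minus_commute)
  have disj: "K \<inter> (\<alpha> ^^ n) ` K = {}" using N0 n by simp
  have bK: "K \<in> sets borel" using K by (simp add: compact_imp_closed)
  \<comment> \<open>Superlevel sets make the bounds on \<open>K - A\<close> and \<open>K - B\<close>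
    automatic. On them the reciprocal weight, that of the opposite power, is below
    \<open>1 / d\<close>.\<close>
  define A where "A = K \<inter> {t. d < P n t}"
  define B where "B = K \<inter> {t. d < Q n t}"
  have "{t. d < P n t} = P n -` {d<..}" "{t. d < Q n t} = Q n -` {d<..}" by auto
  then have "{t. d < P n t} \<in> sets borel" "{t. d < Q n t} \<in> sets borel"
    using measurable_sets[OF P_borel, of "{d<..}"] measurable_sets[OF Q_borel, of "{d<..}"] by auto
  then have b: "A \<in> sets borel" "B \<in> sets borel" unfolding A_def B_def using bK by auto
  have c: "0 \<le> 1 / d" using d by simp
  have total: "4 * (1 / d) * x + y \<le> d" if "x \<le> e" "y \<le> e" for x y
  proof -
    have "4 * (1 / d) * x + y \<le> 4 * (1 / d) * e + e"
      using that d by (intro add_mono mult_left_mono) auto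
    also have "\<dots> = d / 2 + d * d / 8" using d by (simp add: e_def power2_eq_square field_simps)
    also have "d * d \<le> d * 1" using d by (intro mult_left_mono) auto
    finally show ?thesis using d by simp
  qed
  \<comment> \<open>The disjointness estimate for the inverse power, which takes
    \<open>(T ^^ n) \<eta>\<close> back to \<open>\<eta>\<close>.\<close>
  have "norm (restrict_radon A \<mu>) \<le> 4 * (1 / d) * norm ((T ^^ n) \<eta> - \<nu>)
      + norm (\<mu> - weighted_composition_adjoint (inv \<alpha> ^^ n) (Q n) ((T ^^ n) \<eta>))"
  proof (rule norm_restrict_radon_le_of_disjoint[OF homeo_inv_funpow Q_borel abs_Q_le bK b(1) _ _ \<nu> c])
    show "(inv \<alpha> ^^ n) -` K \<inter> K = {}"
    proof -
      have "s \<in> (\<alpha> ^^ n) ` K" if "(inv \<alpha> ^^ n) s \<in> K" for s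
        using that inv_funpow(2)[of n s] by (metis imageI)
      then show ?thesis using disj by blast
    qed
    fix s assume "(inv \<alpha> ^^ n) s \<in> A"
    then have "d < P n ((inv \<alpha> ^^ n) s)" by (simp add: A_def)
    moreover have "Q n s = 1 / P n ((inv \<alpha> ^^ n) s)"
      using Q_funpow[of n "(inv \<alpha> ^^ n) s"] by (simp add: inv_funpow)
    ultimately show "\<bar>Q n s\<bar> \<le> 1 / d" using d by (simp add: frac_le)
  qed (simp add: A_def)
  also have "weighted_composition_adjoint (inv \<alpha> ^^ n) (Q n) ((T ^^ n) \<eta>) = \<eta>"
    by (metis S_funpow S_T_funpow)
  also have "4 * (1 / d) * norm ((T ^^ n) \<eta> - \<nu>) + norm (\<mu> - \<eta>) \<le> d"
    using dist by (intro total)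
  finally have A: "norm (restrict_radon A \<mu>) \<le> d" .
  \<comment> \<open>The same estimate for the forward power, with \<open>P\<close> and
    \<open>Q\<close> and the two measures exchanged.\<close>
  have "norm (restrict_radon B \<nu>) \<le> 4 * (1 / d) * norm (\<eta> - \<mu>)
      + norm (\<nu> - weighted_composition_adjoint (\<alpha> ^^ n) (P n) \<eta>)"
  proof (rule norm_restrict_radon_le_of_disjoint[OF homeo_funpow P_borel abs_P_le bK b(2) _ _ \<mu> c])
    show "(\<alpha> ^^ n) -` K \<inter> K = {}" using disj by blast
    fix s assume "(\<alpha> ^^ n) s \<in> B"
    then have "d < Q n ((\<alpha> ^^ n) s)" by (simp add: B_def)
    moreover have "P n s = 1 / Q n ((\<alpha> ^^ n) s)" by (simp add: Q_funpow)
    ultimately show "\<bar>P n s\<bar> \<le> 1 / d" using d by (simp add: frac_le)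
  qed (simp add: B_def)
  also have "weighted_composition_adjoint (\<alpha> ^^ n) (P n) \<eta> = (T ^^ n) \<eta>"
    by (simp add: T_funpow)
  also have "4 * (1 / d) * norm (\<eta> - \<mu>) + norm (\<nu> - (T ^^ n) \<eta>) \<le> d"
    using dist by (intro total)
  finally have B: "norm (restrict_radon B \<nu>) \<le> d" .
  have "N < n" using n by simp
  moreover have "A \<subseteq> K" "B \<subseteq> K" by (auto simp: A_def B_def)
  moreover have "(\<alpha> ^^ n) ` K \<inter> K = {}" using disj by blast
  moreover have "P n t \<le> d" if "t \<in> K - A" for t using that by (auto simp: A_def)
  moreover have "Q n t \<le> d" if "t \<in> K - B" for t using that by (auto simp: B_def)
  ultimately show thesis using that b A B by blast
qed

text \<open>Dependent choice takes precision \<open>1 / Suc k\<close> at stage \<open>k\<close> and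
  an exponent larger than the previous one, which gives the limits and strict monotonicity
  together.\<close>

lemma decay_if_topologically_hyper_transitive:
  assumes T: "topologically_hyper_transitive T" and \<alpha>: "aperiodic \<alpha>"
    and K: "compact K" and \<mu>: "restrict_radon (- K) \<mu> = 0" and \<nu>: "restrict_radon (- K) \<nu> = 0"
  shows "decay K \<mu> \<nu>"
proof -
  define good where "good d x = (case x of (n, A, B) \<Rightarrow>
      0 < n \<and> A \<in> sets borel \<and> A \<subseteq> K \<and> B \<in> sets borel \<and> B \<subseteq> K \<and> (\<alpha> ^^ n) ` K \<inter> K = {} \<and>
      emeasure (abs_measure \<mu>) A \<le> ennreal d \<and> emeasure (abs_measure \<nu>) B \<le> ennreal d \<and>
      (SUP t\<in>K \<inter> - A. ennreal (P n t)) \<le> ennreal d \<and> (SUP t\<in>K \<inter> - B. ennreal (Q n t)) \<le> ennreal d)"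
    for d :: real and x :: "nat \<times> 'a set \<times> 'a set"
  have ex: "\<exists>x. good d x \<and> N < fst x" if d: "0 < d" "d \<le> 1" for d N
  proof -
    obtain n A B where *: "N < n" "A \<in> sets borel" "A \<subseteq> K" "B \<in> sets borel" "B \<subseteq> K"
      "(\<alpha> ^^ n) ` K \<inter> K = {}" "norm (restrict_radon A \<mu>) \<le> d" "norm (restrict_radon B \<nu>) \<le> d"
      "\<And>t. t \<in> K - A \<Longrightarrow> P n t \<le> d" "\<And>t. t \<in> K - B \<Longrightarrow> Q n t \<le> d"
      using ex_small_sets[OF T \<alpha> K \<mu> \<nu> d] by blast
    then have "good d (n, A, B)"
      by (auto simp: good_def emeasure_abs_measure_eq_norm intro!: SUP_least ennreal_leI)
    then show ?thesis using *(1) by (intro exI[of _ "(n, A, B)"]) simp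
  qed
  have "\<exists>f. \<forall>k. good (1 / Suc k) (f k) \<and> fst (f k) < fst (f (Suc k))"
  proof (rule dependent_nat_choice)
    show "\<exists>x. good (1 / Suc 0) x" using ex[of 1 0] by auto
    show "\<exists>y. good (1 / Suc (Suc k)) y \<and> fst x < fst y"
      for x :: "nat \<times> 'a set \<times> 'a set" and k
      using ex[of "1 / Suc (Suc k)"] by auto
  qed
  then obtain f where f: "\<And>k. good (1 / Suc k) (f k)" "\<And>k. fst (f k) < fst (f (Suc k))" by blast
  define n A B where "n k = fst (f k)" and "A k = fst (snd (f k))" and "B k = snd (snd (f k))" for k
  have good: "good (1 / Suc k) (n k, A k, B k)" for k using f(1)[of k] by (simp add: n_def A_def B_def)
  have zero: "x \<longlonglongrightarrow> 0" if "\<And>k. x k \<le> ennreal (1 / Suc k)" for x :: "nat \<Rightarrow> ennreal"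
  proof (rule tendsto_sandwich[of "\<lambda>_. 0"])
    show "(\<lambda>k. ennreal (1 / Suc k)) \<longlonglongrightarrow> 0"
      using tendsto_ennrealI[OF LIMSEQ_inverse_real_of_nat] by (simp add: inverse_eq_divide)
  qed (use that in auto)
  have "strict_mono n" using f(2) by (simp add: strict_mono_Suc_iff n_def)
  moreover have "(\<lambda>k. emeasure (abs_measure \<mu>) (A k)) \<longlonglongrightarrow> 0" "(\<lambda>k. emeasure (abs_measure \<nu>) (B k)) \<longlonglongrightarrow> 0"
    "(\<lambda>k. SUP t\<in>K \<inter> - A k. ennreal (P (n k) t)) \<longlonglongrightarrow> 0"
    "(\<lambda>k. SUP t\<in>K \<inter> - B k. ennreal (Q (n k) t)) \<longlonglongrightarrow> 0"
    using good unfolding good_def by (auto intro!: zero)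
  moreover have "0 < n k" "A k \<in> sets borel" "A k \<subseteq> K" "B k \<in> sets borel" "B k \<subseteq> K"
    "(\<alpha> ^^ n k) ` K \<inter> K = {}" for k
    using good[of k] unfolding good_def by auto
  ultimately show ?thesis unfolding decay_def by blast
qed

section \<open>Decay of the weight products implies transitivity\<close>

text \<open>Each error consists of a part that was cut away, on \<open>A\<close> or
  \<open>B\<close>, and a part that the power of \<open>T\<close> or \<open>S\<close> shrinks
  because its weight is at most \<open>d\<close> where the truncated measure lives.\<close>

lemma norm_approximate_orbit:
  assumes bK: "K \<in> sets borel" and A: "A \<in> sets borel" "A \<subseteq> K" and B: "B \<in> sets borel" "B \<subseteq> K"
    and \<mu>: "restrict_radon (- K) \<mu> = 0" and \<nu>: "restrict_radon (- K) \<nu> = 0"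
    and d: "0 \<le> d" "\<And>t. t \<in> K - A \<Longrightarrow> P n t \<le> d" "\<And>t. t \<in> K - B \<Longrightarrow> Q n t \<le> d"
  defines "\<eta> \<equiv> restrict_radon (K - A) \<mu> + (S ^^ n) (restrict_radon (K - B) \<nu>)"
  shows "norm (\<mu> - \<eta>) \<le> norm (restrict_radon A \<mu>) + 4 * d * norm \<nu>"
    and "norm (\<nu> - (T ^^ n) \<eta>) \<le> norm (restrict_radon B \<nu>) + 4 * d * norm \<mu>"
proof -
  have m: "K - A \<in> sets borel" "K - B \<in> sets borel" using bK A B by auto
  have "norm ((S ^^ n) (restrict_radon (K - B) \<nu>)) \<le> 4 * d * norm (restrict_radon (K - B) \<nu>)"
    unfolding S_funpow using d Q_pos
    by (intro norm_weighted_composition_adjoint_restrict_radon_le[OF homeo_inv_funpow Q_borel abs_Q_le m(2)])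
      (auto simp: abs_of_pos)
  also have "\<dots> \<le> 4 * d * norm \<nu>" using d by (intro mult_left_mono norm_restrict_radon_le m) auto
  finally have SB: "norm ((S ^^ n) (restrict_radon (K - B) \<nu>)) \<le> 4 * d * norm \<nu>" .
  have "norm ((T ^^ n) (restrict_radon (K - A) \<mu>)) \<le> 4 * d * norm (restrict_radon (K - A) \<mu>)"
    unfolding T_funpow using d P_pos
    by (intro norm_weighted_composition_adjoint_restrict_radon_le[OF homeo_funpow P_borel abs_P_le m(1)])
      (auto simp: abs_of_pos)
  also have "\<dots> \<le> 4 * d * norm \<mu>" using d by (intro mult_left_mono norm_restrict_radon_le m) auto
  finally have TA: "norm ((T ^^ n) (restrict_radon (K - A) \<mu>)) \<le> 4 * d * norm \<mu>" .
  have "\<mu> - \<eta> = restrict_radon A \<mu> - (S ^^ n) (restrict_radon (K - B) \<nu>)"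
    using diff_restrict_radon[OF bK A \<mu>] by (simp add: \<eta>_def algebra_simps)
  then show "norm (\<mu> - \<eta>) \<le> norm (restrict_radon A \<mu>) + 4 * d * norm \<nu>"
    using norm_triangle_ineq4[of "restrict_radon A \<mu>" "(S ^^ n) (restrict_radon (K - B) \<nu>)"] SB by simp
  have "(T ^^ n) (x + y) = (T ^^ n) x + (T ^^ n) y" for x y
    unfolding T_funpow
    by (rule linear_add[OF bounded_linear.linear[OF bounded_linear_weighted_composition_adjoint[OF
              homeo_funpow P_borel abs_P_le]]])
  then have "\<nu> - (T ^^ n) \<eta> = restrict_radon B \<nu> - (T ^^ n) (restrict_radon (K - A) \<mu>)"
    using diff_restrict_radon[OF bK B \<nu>] by (simp add: \<eta>_def T_S_funpow algebra_simps)
  then show "norm (\<nu> - (T ^^ n) \<eta>) \<le> norm (restrict_radon B \<nu>) + 4 * d * norm \<mu>"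
    using norm_triangle_ineq4[of "restrict_radon B \<nu>" "(T ^^ n) (restrict_radon (K - A) \<mu>)"] TA by simp
qed

lemma topologically_hyper_transitive_if_decay:
  assumes decay: "\<And>K \<mu> \<nu>. compact K \<Longrightarrow> restrict_radon (- K) \<mu> = 0 \<Longrightarrow> restrict_radon (- K) \<nu> = 0 \<Longrightarrow> decay K \<mu> \<nu>"
  shows "topologically_hyper_transitive T"
  unfolding topologically_hyper_transitive_def
proof (intro allI impI)
  fix U V :: "'a complex_radon_measure set"
  assume U: "open U" "U \<noteq> {}" and V: "open V" "V \<noteq> {}"
  obtain x y where xy: "x \<in> U" "y \<in> V" using U V by blast
  obtain e1 e2 where e12: "0 < e1" "ball x e1 \<subseteq> U" "0 < e2" "ball y e2 \<subseteq> V"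
    using U(1) V(1) xy by (metis open_contains_ball)
  define e where "e = min e1 e2"
  have e: "0 < e" "ball x e \<subseteq> U" "ball y e \<subseteq> V" using e12 by (auto simp: e_def)
  \<comment> \<open>Half of the radius pays for compact support; the other half is left for the
    orbit, as \<open>e / 4\<close> for truncation and \<open>e / 4\<close> for the shrunken
    part.\<close>
  obtain K where K: "compact K" "norm (x - restrict_radon K x) < e / 2" "norm (y - restrict_radon K y) < e / 2"
    using radon_inner_approximation[of "e / 2" x y] e(1) by auto
  have bK: "K \<in> sets borel" using K(1) by (simp add: compact_imp_closed)
  define \<mu> \<nu> where "\<mu> = restrict_radon K x" and "\<nu> = restrict_radon K y"
  have null: "restrict_radon (- K) \<mu> = 0" "restrict_radon (- K) \<nu> = 0"
    using bK by (simp_all add: \<mu>_def \<nu>_def restrict_radon_restrict_radon)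
  obtain n A B where nAB: "strict_mono (n :: nat \<Rightarrow> nat)" "\<And>k. 0 < n k"
        "\<And>k. A k \<in> sets borel" "\<And>k. A k \<subseteq> K" "\<And>k. B k \<in> sets borel" "\<And>k. B k \<subseteq> K"
        "(\<lambda>k. emeasure (abs_measure \<mu>) (A k)) \<longlonglongrightarrow> 0"
        "(\<lambda>k. emeasure (abs_measure \<nu>) (B k)) \<longlonglongrightarrow> 0"
        "(\<lambda>k. SUP t\<in>K \<inter> - A k. ennreal (P (n k) t)) \<longlonglongrightarrow> 0"
        "(\<lambda>k. SUP t\<in>K \<inter> - B k. ennreal (Q (n k) t)) \<longlonglongrightarrow> 0"
    using decay[OF K(1) null] unfolding decay_def by meson
  \<comment> \<open>This makes \<open>4 * d\<close> times either norm at most \<open>e / 4\<close>;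
    the summand 1 keeps the denominator positive if both measures vanish.\<close>
  define d where "d = e / (16 * (norm \<mu> + norm \<nu> + 1))"
  have scale: "4 * (e / (16 * s)) * s = e / 4" if "0 < s" for s :: real
    using that by simp
  have M: "0 < norm \<mu> + norm \<nu> + 1" by (simp add: add_nonneg_pos)
  have d: "0 < d" using e(1) M by (simp add: d_def)
  have "4 * d * (norm \<mu> + norm \<nu> + 1) = e / 4"
    unfolding d_def using M by (rule scale)
  moreover have "4 * d * norm \<mu> \<le> 4 * d * (norm \<mu> + norm \<nu> + 1)"
    "4 * d * norm \<nu> \<le> 4 * d * (norm \<mu> + norm \<nu> + 1)"
    using d by (intro mult_left_mono; simp)+
  ultimately have d_le: "4 * d * norm \<mu> \<le> e / 4" "4 * d * norm \<nu> \<le> e / 4" by simp_all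
  have "\<forall>\<^sub>F k in sequentially. emeasure (abs_measure \<mu>) (A k) < ennreal (e / 4) \<and>
      emeasure (abs_measure \<nu>) (B k) < ennreal (e / 4) \<and>
      (SUP t\<in>K \<inter> - A k. ennreal (P (n k) t)) < ennreal d \<and>
      (SUP t\<in>K \<inter> - B k. ennreal (Q (n k) t)) < ennreal d"
    using nAB(7-10) d e(1) by (intro eventually_conj order_tendstoD(2)) auto
  then obtain k0 where k0: "\<And>k. k0 \<le> k \<Longrightarrow> emeasure (abs_measure \<mu>) (A k) < ennreal (e / 4) \<and>
      emeasure (abs_measure \<nu>) (B k) < ennreal (e / 4) \<and>
      (SUP t\<in>K \<inter> - A k. ennreal (P (n k) t)) < ennreal d \<and>
      (SUP t\<in>K \<inter> - B k. ennreal (Q (n k) t)) < ennreal d"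
    unfolding eventually_sequentially by blast
  have hit: "(T ^^ n k) ` U \<inter> V \<noteq> {}" if k: "k0 \<le> k" for k
  proof -
    have small: "norm (restrict_radon (A k) \<mu>) < e / 4" "norm (restrict_radon (B k) \<nu>) < e / 4"
      using k0[OF k] nAB(3,5)[of k] by (simp_all add: emeasure_abs_measure_eq_norm ennreal_less_iff)
    have P: "P (n k) t \<le> d" if "t \<in> K - A k" for t
    proof -
      have "ennreal (P (n k) t) \<le> (SUP t\<in>K \<inter> - A k. ennreal (P (n k) t))"
        using that by (intro SUP_upper) auto
      also have "\<dots> < ennreal d" using k0[OF k] by blast
      finally show ?thesis using d by (simp add: ennreal_less_iff P_pos less_imp_le)
    qed
    have Q: "Q (n k) t \<le> d" if "t \<in> K - B k" for t
    proof -
      have "ennreal (Q (n k) t) \<le> (SUP t\<in>K \<inter> - B k. ennreal (Q (n k) t))"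
        using that by (intro SUP_upper) auto
      also have "\<dots> < ennreal d" using k0[OF k] by blast
      finally show ?thesis using d by (simp add: ennreal_less_iff Q_pos less_imp_le)
    qed
    define \<eta> where "\<eta> = restrict_radon (K - A k) \<mu> + (S ^^ n k) (restrict_radon (K - B k) \<nu>)"
    have "norm (\<mu> - \<eta>) < e / 2" "norm (\<nu> - (T ^^ n k) \<eta>) < e / 2"
      using norm_approximate_orbit[OF bK nAB(3-6)[of k] null less_imp_le[OF d] P Q, folded \<eta>_def]
        small d_le by auto
    then have "dist x \<eta> < e" "dist y ((T ^^ n k) \<eta>) < e"
      using K(2,3) norm_triangle_lt[of "x - \<mu>" "\<mu> - \<eta>" e] norm_triangle_lt[of "y - \<nu>" "\<nu> - (T ^^ n k) \<eta>" e]
      by (auto simp: \<mu>_def \<nu>_def dist_norm)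
    then have "\<eta> \<in> U" "(T ^^ n k) \<eta> \<in> V" using e by auto
    then show ?thesis by blast
  qed
  \<comment> \<open>The estimates hold from \<open>k0\<close> on, while hyper-transitivity asks for
    every term, so the sequence is shifted.\<close>
  have "strict_mono (\<lambda>k. n (k + k0))" using nAB(1) by (simp add: strict_mono_def)
  then show "\<exists>n :: nat \<Rightarrow> nat. strict_mono n \<and> (\<forall>k. 0 < n k) \<and> (\<forall>k. (T ^^ n k) ` U \<inter> V \<noteq> {})"
    using nAB(2) hit by (intro exI[of _ "\<lambda>k. n (k + k0)"]) auto
qed

end

section \<open>Equivalence of hyper-transitivity and decay\<close>

theorem proposition3p1:
  fixes \<alpha> :: "'a::t2_space \<Rightarrow> 'a" and w :: "'a \<Rightarrow> real"
  assumes "locally_compact_space (euclidean :: 'a topology)"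
    and "homeomorphic_map euclidean euclidean \<alpha>"
    and "aperiodic \<alpha>"
    and "\<forall>t. 0 < w t" and "bounded (range w)" and "(\<lambda>t. 1 / w t) \<in> bcontfun"
  shows "topologically_hyper_transitive (weighted_composition_adjoint \<alpha> w) \<longleftrightarrow>
    (\<forall>(K :: 'a set) (\<mu> :: 'a complex_radon_measure) (v :: 'a complex_radon_measure).
      compact K \<longrightarrow> emeasure (abs_measure v) (- K) = 0 \<longrightarrow> emeasure (abs_measure \<mu>) (- K) = 0 \<longrightarrow>
      (\<exists>(n :: nat \<Rightarrow> nat) (A :: nat \<Rightarrow> 'a set) (B :: nat \<Rightarrow> 'a set).
        strict_mono n \<and> (\<forall>k. 0 < n k) \<and>
        (\<forall>k. A k \<in> sets borel \<and> A k \<subseteq> K) \<and> (\<forall>k. B k \<in> sets borel \<and> B k \<subseteq> K) \<and>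
        (\<forall>k. (\<alpha> ^^ n k) ` K \<inter> K = {}) \<and>
        (\<lambda>k. emeasure (abs_measure \<mu>) (A k)) \<longlonglongrightarrow> 0 \<and>
        (\<lambda>k. emeasure (abs_measure v) (B k)) \<longlonglongrightarrow> 0 \<and>
        (\<lambda>k. SUP t\<in>K \<inter> - A k. ennreal (\<Prod>j=0..<n k. w ((\<alpha> ^^ j) t))) \<longlonglongrightarrow> 0 \<and>
        (\<lambda>k. SUP t\<in>K \<inter> - B k. ennreal (\<Prod>j=1..n k. 1 / w ((inv \<alpha> ^^ j) t))) \<longlonglongrightarrow> 0))"
proof -
  obtain C where C: "\<And>t. \<bar>w t\<bar> \<le> C" using assms(5) by (auto simp: bounded_iff)
  obtain D where D: "\<And>t. \<bar>1 / w t\<bar> \<le> D"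
    using assms(6) unfolding bcontfun_def by (auto simp: bounded_iff)
  have "continuous_on UNIV (\<lambda>t. 1 / w t)" using assms(6) by (auto simp: bcontfun_def)
  \<comment> \<open>Continuity is assumed for the reciprocal of \<open>w\<close>; inverting once
    more gives it for \<open>w\<close>, and with it measurability.\<close>
  then have "continuous_on UNIV (\<lambda>t. 1 / (1 / w t))"
    by (rule continuous_on_divide[OF continuous_on_const]) (use assms(4) in \<open>auto simp: less_imp_neq[symmetric]\<close>)
  then have "w \<in> borel_measurable borel" by (simp add: borel_measurable_continuous_onI)
  then interpret weighted_homeomorphism \<alpha> w C D
    using assms(2,4) abs_le_D1[OF C] abs_le_D1[OF D] by unfold_locales auto
  \<comment> \<open>Rephrases the support condition of (ii) in the form used by both
    implications.\<close>
  have null: "emeasure (abs_measure \<mu>) (- K) = 0 \<longleftrightarrow> restrict_radon (- K) \<mu> = 0"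
    if "compact K" for K and \<mu> :: "'a complex_radon_measure"
    using that by (subst emeasure_abs_measure_eq_norm) (auto simp: compact_imp_closed)
  show ?thesis
    unfolding P_def[symmetric] Q_def[symmetric] decay_def[symmetric]
  proof (intro iffI allI impI)
    fix K :: "'a set" and \<mu> v :: "'a complex_radon_measure"
    assume "topologically_hyper_transitive T" "compact K"
      "emeasure (abs_measure v) (- K) = 0" "emeasure (abs_measure \<mu>) (- K) = 0"
    then show "decay K \<mu> v"
      using assms(3) by (intro decay_if_topologically_hyper_transitive) (simp_all add: null)
  next
    assume "\<forall>K \<mu> v. compact K \<longrightarrow> emeasure (abs_measure v) (- K) = 0 \<longrightarrow>
      emeasure (abs_measure \<mu>) (- K) = 0 \<longrightarrow> decay K \<mu> v"
    then show "topologically_hyper_transitive T"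
      by (intro topologically_hyper_transitive_if_decay) (simp add: null)
  qed
qed

end
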